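(* Let $S_n$ be the final score of player $\mathsf N$ in semi-restricted Rock, Paper, Scissors played over $3n$ rounds when both players use their greedy strategies. Then, as $n\to\infty$, we have convergence in distribution, together with convergence of all moments, $$ n^{-1/2} S_n \overset{\mathrm d}{\longrightarrow} \mathcal S^{\mathrm{gr}} := W+\max\bigl\{V_1+2V_2,\; V_2+2V_3,\; V_3+2V_1\bigr\},$$ where $W,V_1,V_2,V_3$ are jointly normal with $W$ independent of $(V_1,V_2,V_3)$, and $$W\sim N(0,2),\qquad (V_1,V_2,V_3)\sim N\left(0,\begin{pmatrix} \frac23&-\frac13&-\frac13\\ -\frac13&\frac23&-\frac13\\ -\frac13&-\frac13&\frac23\end{pmatrix}\right).$$
   Context: Semi-restricted Rock, Paper, Scissors over $3n$ rounds: there are two players, $\mathsf R$ (restricted) and $\mathsf N$ (normal), and three moves rock, paper, scissors, numbered $1,2,3$, where move $i+1$ beats move $i$ (indices mod 3). In each of $3n$ rounds both players simultaneously choose a move, knowing all moves made in earlier rounds; choices may be randomized (and, given the history, the two players' choices in a round are independent). $\mathsf R$ must choose each of the three moves exactly $n$ times during the $3n$ rounds; $\mathsf N$ is unrestricted. A round in which both select the same move is a draw. The final score $S_n$ is the number of rounds won by $\mathsf N$ minus the number of rounds won by $\mathsf R$. Greedy strategies (in each round, each player plays the optimal strategy for the expected score of that single round, with fresh independent randomness, given which moves $\mathsf R$ still has available): - If $\mathsf R$ still has all three moves available, each player chooses each of the three moves with probability $1/3$. - If $\mathsf R$ has exactly two moves available, say $i$ and $i+1$ (mod 3), then $\mathsf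 R$ plays $i$ with probability $1/3$ and $i+1$ with probability $2/3$, and $\mathsf N$ plays $i+1$ with probability $2/3$ and $i+2$ with probability $1/3$. - If $\mathsf R$ has only one move $i$ available, $\mathsf R$ plays $i$ and $\mathsf N$ plays $i+1$. $N(0,\Sigma)$ denotes the (possibly degenerate) normal distribution with mean $0$ and variance, or covariance matrix, $\Sigma$. "Together with all moments" means that moments of $n^{-1/2}S_n$ of every order converge to the corresponding moments of the limit. *)

theory Defs
  imports "HOL-Probability.Probability"
begin

text \<open>
  The moves 1, 2, 3 are the elements of the three-element type, whose arithmetic is modulo 3
  (so \<open>3 = 0\<close>); move \<open>i + 1\<close> beats move \<open>i\<close>.
\<close>

type_synonym move = "3"

text \<open>
  A history lists the pairs (move of the restricted player, move of the normal player),
  in chronological order.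
\<close>

type_synonym history = "(move \<times> move) list"

type_synonym strategy = "history \<Rightarrow> move pmf"

fun play :: "strategy \<Rightarrow> strategy \<Rightarrow> nat \<Rightarrow> history pmf" where
  "play \<rho> \<nu> 0 = return_pmf []"
| "play \<rho> \<nu> (Suc k) =
     bind_pmf (play \<rho> \<nu> k) (\<lambda>h. map_pmf (\<lambda>x. h @ [x]) (pair_pmf (\<rho> h) (\<nu> h)))"

definition round_score :: "move \<times> move \<Rightarrow> int" where
  "round_score = (\<lambda>(r, s). if s = r + 1 then 1 else if r = s + 1 then -1 else 0)"

definition score :: "history \<Rightarrow> int" where
  "score h = (\<Sum>x\<leftarrow>h. round_score x)"

definition available :: "nat \<Rightarrow> history \<Rightarrow> move set" where
  "available n h = {i. count_list (map fst h) i < n}"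

text \<open>
  A two-element set of moves has the form \<open>{i, i + 1}\<close> for exactly one \<open>i\<close>, so the definite
  descriptions below are well defined (\<open>two_moves_unique\<close>).  The set of available moves is
  nonempty in each of the \<open>3 * n\<close> rounds, so in the last case it is a singleton.
\<close>

definition greedy_R :: "nat \<Rightarrow> strategy" where
  "greedy_R n h = (let A = available n h in
     if A = UNIV then pmf_of_set UNIV
     else if card A = 2 then
       (let i = (THE i. A = {i, i + 1}) in
          map_pmf (\<lambda>b. if b then i else i + 1) (bernoulli_pmf (1 / 3)))
     else return_pmf (the_elem A))"

definition greedy_N :: "nat \<Rightarrow> strategy" where
  "greedy_N n h = (let A = available n h in
     if A = UNIV then pmf_of_set UNIV
     else if card A = 2 then
       (let i = (THE i. A = {i, i + 1}) in
          map_pmf (\<lambda>b. if b then i + 1 else i + 2) (bernoulli_pmf (2 / 3)))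
     else return_pmf (the_elem A + 1))"

lemma two_moves_unique:
  fixes A :: "move set"
  assumes "card A = 2"
  shows "\<exists>!i. A = {i, i + 1}"
proof -
  obtain x y where xy: "A = {x,y}" "x \<noteq> y" using assms unfolding card_2_iff by blast
  have "(x = 1 \<or> x = 2 \<or> x = 3)" "(y = 1 \<or> y = 2 \<or> y = 3)" by (rule exhaust_3)+
  hence "A = {1,2} \<or> A = {2,3} \<or> A = {3,1}" using xy by (elim disjE) (simp_all add: insert_commute)
  moreover have "(1::move) + 1 = 2" "(2::move) + 1 = 3" "(3::move) + 1 = 1" by simp_all
  ultimately have "\<exists>i. A = {i, i + 1}" by metis
  moreover have "i = j" if "{i,i+1} = {j,j+1}" for i j :: 3
  proof (rule ccontr)
    assume "i \<noteq> j"
    with that have "i = j + 1" "i + 1 = j" unfolding doubleton_eq_iff by blast+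
    hence "j + (1 + 1) = j + 0" by (simp only: add.assoc add_0_right)
    hence "(1::3) + 1 = 0" by (simp only: add_left_cancel)
    thus False by simp
  qed
  ultimately show ?thesis by blast
qed

lemma set_greedy_R:
  assumes "available n h \<noteq> {}"
  shows "set_pmf (greedy_R n h) \<subseteq> available n h"
proof -
  let ?A = "available n h"
  have c3: "card ?A \<le> 3" using card_mono[of "UNIV::3 set" ?A] by simp
  consider "?A = UNIV" | "?A \<noteq> UNIV" "card ?A = 2" | "?A \<noteq> UNIV" "card ?A = 1"
  proof -
    have "card ?A \<noteq> 0" using assms by simp
    moreover have "card ?A = 3 \<Longrightarrow> ?A = UNIV" by (intro card_subset_eq) auto
    ultimately show ?thesis using that c3 by linarith
  qed
  thus ?thesis
  proof cases
    case 1 thus ?thesis by simp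
  next
    case 2
    define i where "i = (THE i. ?A = {i, i + 1})"
    have A: "?A = {i, i + 1}"
      unfolding i_def by (rule theI'[OF two_moves_unique[OF 2(2)]])
    have "greedy_R n h = map_pmf (\<lambda>b. if b then i else i + 1) (bernoulli_pmf (1 / 3))"
      unfolding greedy_R_def Let_def i_def using 2 by simp
    hence "set_pmf (greedy_R n h) \<subseteq> {i, i + 1}" by auto
    thus ?thesis by (simp only: A)
  next
    case 3
    then obtain a where A: "?A = {a}" unfolding One_nat_def card_1_singleton_iff by blast
    have "greedy_R n h = return_pmf (the_elem ?A)"
      unfolding greedy_R_def Let_def using 3 by simp
    thus ?thesis by (simp add: A)
  qed
qed

lemma sum_count_moves: "(\<Sum>i\<in>UNIV. count_list (xs :: move list) i) = length xs"
  by (rule sum_count_set) auto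

lemma play_greedy_R_inv:
  assumes "h \<in> set_pmf (play (greedy_R n) \<nu> k)" "k \<le> 3 * n"
  shows "length h = k \<and> (\<forall>i. count_list (map fst h) i \<le> n)"
  using assms
proof (induction k arbitrary: h)
  case 0 thus ?case by simp
next
  case (Suc k)
  then obtain g r s where g: "g \<in> set_pmf (play (greedy_R n) \<nu> k)" "r \<in> set_pmf (greedy_R n g)"
    "h = g @ [(r,s)]" by auto
  have IH: "length g = k" "\<And>i. count_list (map fst g) i \<le> n" using Suc.IH[OF g(1)] Suc.prems by auto
  have "available n g \<noteq> {}"
  proof
    assume "available n g = {}"
    hence "count_list (map fst g) i = n" for i
      using IH(2)[of i] unfolding available_def by (metis empty_iff le_neq_implies_less mem_Collect_eq)
    hence "(\<Sum>i\<in>(UNIV::move set). n) = length (map fst g)"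
      unfolding sum_count_moves[symmetric] by presburger
    thus False using IH(1) Suc.prems by simp
  qed
  hence "r \<in> available n g" using set_greedy_R g(2) by blast
  thus ?case using IH g(3) by (auto simp: available_def count_list_append Suc_le_eq)
qed

text \<open>
  Under \<open>greedy_R\<close> the restriction is respected: each move is made exactly \<open>n\<close> times.
\<close>

lemma play_greedy_R_legal:
  assumes "h \<in> set_pmf (play (greedy_R n) \<nu> (3 * n))"
  shows "count_list (map fst h) i = n"
proof (rule antisym)
  have h: "length h = 3 * n" "\<And>i. count_list (map fst h) i \<le> n"
    using play_greedy_R_inv[OF assms] by auto
  show "count_list (map fst h) i \<le> n" by (rule h)
  show "n \<le> count_list (map fst h) i"
  proof (rule ccontr)
    assume "\<not> n \<le> count_list (map fst h) i"
    hence "(\<Sum>i\<in>UNIV. count_list (map fst h) i) < (\<Sum>i\<in>(UNIV::3 set). n)"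
      using h(2) by (intro sum_strict_mono_ex1 finite ballI bexI[of _ i]) (simp_all add: not_le)
    hence "length (map fst h) < 3 * n" unfolding sum_count_moves by simp
    thus False using h(1) by simp
  qed
qed

definition greedy_score :: "nat \<Rightarrow> int pmf" where
  "greedy_score n = map_pmf score (play (greedy_R n) (greedy_N n) (3 * n))"

definition scaled_greedy_score :: "nat \<Rightarrow> real measure" where
  "scaled_greedy_score n =
     distr (measure_pmf (greedy_score n)) borel (\<lambda>s. of_int s / sqrt (real n))"

text \<open>
  Joint normality allows degenerate laws: every linear functional is almost surely constant
  or has a normal density.
\<close>

definition jointly_normal :: "'a measure \<Rightarrow> ('a \<Rightarrow> 'b::euclidean_space) \<Rightarrow> bool" where
  "jointly_normal M X \<longleftrightarrow> X \<in> borel_measurable M \<and>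
     (\<forall>t. (\<exists>c. AE \<omega> in M. t \<bullet> X \<omega> = c) \<or>
          (\<exists>\<mu> \<sigma>. \<sigma> > 0 \<and> distributed M lborel (\<lambda>\<omega>. t \<bullet> X \<omega>) (normal_density \<mu> \<sigma>)))"

definition multivariate_normal ::
    "'a measure \<Rightarrow> ('a \<Rightarrow> real^'n) \<Rightarrow> real^'n \<Rightarrow> real^'n^'n \<Rightarrow> bool" where
  "multivariate_normal M X \<mu> \<Sigma> \<longleftrightarrow> jointly_normal M X \<and>
     (\<forall>i. integral\<^sup>L M (\<lambda>\<omega>. X \<omega> $ i) = \<mu> $ i) \<and>
     (\<forall>i j. integral\<^sup>L M (\<lambda>\<omega>. (X \<omega> $ i - \<mu> $ i) * (X \<omega> $ j - \<mu> $ j)) = \<Sigma> $ i $ j)"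

end

theory Submission
  imports Defs
begin

text \<open>
  The score splits at the first round in which one of the moves has been used up. Before it, both
  players play uniformly and independently, so the score and the numbers of moves made form a
  random walk with independent bounded steps. It lasts until \<open>O (sqrt n)\<close> rounds before the end.
  What is scored from then on has fluctuations of order \<open>n powr (1 / 4)\<close> only and is governed by its
  drift: if move \<open>j\<close> is exhausted and \<open>a\<close>, \<open>b\<close> copies of \<open>j + 1\<close>, \<open>j + 2\<close> remain, the normal player gains
  \<open>1 / 3\<close> per round on average until one more move runs out and \<open>1\<close> per round afterwards, which
  amounts to about \<open>max (b - a) a\<close>.

  If instead the uniform walk is continued to round \<open>3 * n\<close> and \<open>x i\<close> denotes the final excess of move \<open>i\<close>
  over \<open>n\<close>, then, up to \<open>O (n powr (1 / 4))\<close>, the same number is the maximum of \<open>x j + 2 * x (j + 1)\<close>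
  over the three moves \<open>j\<close>. Hence the score is close to a Lipschitz function, \<open>limit_score\<close>, of the
  endpoint of a random walk in four-dimensional space, and the central limit theorem gives the limit.

  This comparison needs no coupling. The value \<open>E f (score)\<close> as a function of the remaining
  moves, and the corresponding value for the uniform walk, obey the same averaging recursion as long
  as all three moves remain (\<open>greedy_rest_close\<close>); their difference is thus controlled by any function
  harmonic for the uniform recursion that dominates it at states where a move is exhausted. A
  quadratic function (\<open>spread\<close>) does this. At those states, a second quadratic potential
  bounds the variance of the remaining score (\<open>greedy_rest_two_deviation\<close>). An exponential potential
  in the same spirit bounds all moments of the normalised score (\<open>exponential_moment_greedy_rest\<close>),
  which turns weak convergence into convergence of moments (\<open>moment_conv\<close>).

  For the walk, a central limit theorem for each linear functional is enough, because convergence of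
  characteristic functions in a Euclidean space implies convergence of expectations of all bounded
  continuous functions (\<open>bounded_continuous_conv\<close>). This also spares the identification of the joint
  law of the limiting vector, of which only the characteristic function is used.
\<close>

section \<open>Characteristic functions and bounded continuous test functions in Euclidean space\<close>

text \<open>
  Real parts of characteristic functions are expectations of waves, so convergence of
  characteristic functions is convergence of expectations of trigonometric sums. Constants
  (\<open>t = 0\<close>) and sines (by a phase shift) are included.
\<close>
inductive trigonometric_sum :: "('b::real_inner \<Rightarrow> real) \<Rightarrow> bool" where
  wave: "trigonometric_sum (\<lambda>x. a * cos (t \<bullet> x + \<theta>))"
| add: "trigonometric_sum f \<Longrightarrow> trigonometric_sum g \<Longrightarrow> trigonometric_sum (\<lambda>x. f x + g x)"

lemma trigonometric_sum_const: "trigonometric_sum (\<lambda>x. c)"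
  using wave[of c 0 0] by simp

lemma trigonometric_sum_sum:
  assumes "\<And>i. i \<in> I \<Longrightarrow> trigonometric_sum (f i)"
  shows "trigonometric_sum (\<lambda>x. \<Sum>i\<in>I. f i x)"
  using assms
  by (induction I rule: infinite_finite_induct) (auto intro: trigonometric_sum_const trigonometric_sum.add)

lemma trigonometric_sum_mult_wave:
  assumes "trigonometric_sum g"
  shows "trigonometric_sum (\<lambda>x. (a * cos (t \<bullet> x + \<theta>)) * g x)"
  using assms
proof induction
  case (wave b s \<phi>)
  have *: "(a * cos (t \<bullet> x + \<theta>)) * (b * cos (s \<bullet> x + \<phi>)) =
      (a * b / 2) * cos ((t - s) \<bullet> x + (\<theta> - \<phi>)) + (a * b / 2) * cos ((t + s) \<bullet> x + (\<theta> + \<phi>))" for x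
  proof -
    have "(t - s) \<bullet> x + (\<theta> - \<phi>) = (t \<bullet> x + \<theta>) - (s \<bullet> x + \<phi>)"
      "(t + s) \<bullet> x + (\<theta> + \<phi>) = (t \<bullet> x + \<theta>) + (s \<bullet> x + \<phi>)"
      by (simp_all add: inner_diff_left inner_add_left)
    thus ?thesis by (simp only: cos_diff cos_add) (simp add: field_simps)
  qed
  show ?case unfolding * by (intro trigonometric_sum.intros)
next
  case (add f g)
  thus ?case by (simp add: distrib_left trigonometric_sum.add)
qed

lemma trigonometric_sum_mult:
  assumes "trigonometric_sum f" "trigonometric_sum g"
  shows "trigonometric_sum (\<lambda>x. f x * g x)"
  using assms(1)
proof induction
  case (wave a t \<theta>)
  show ?case by (rule trigonometric_sum_mult_wave[OF assms(2)])
next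
  case (add f h)
  thus ?case by (simp add: distrib_right trigonometric_sum.add)
qed

text \<open>
  Products of waves are sums of waves, so trigonometric sums form an algebra; a polynomial in the
  sines of the coordinates therefore belongs to it.
\<close>
lemma trigonometric_sum_polynomial_of_sines:
  fixes g :: "'b::euclidean_space \<Rightarrow> real"
  assumes "real_polynomial_function g"
  shows "trigonometric_sum (\<lambda>x::'b. g (\<Sum>b\<in>Basis. sin ((x \<bullet> b) / L) *\<^sub>R b))"
  using assms
proof induction
  case (linear f)
  then interpret bounded_linear f .
  have *: "f (\<Sum>b\<in>Basis. sin ((x \<bullet> b) / L) *\<^sub>R b) =
     (\<Sum>b\<in>Basis. f b * cos (((1 / L) *\<^sub>R b) \<bullet> x + (- pi / 2)))" for x :: 'b
    by (simp add: sum scaleR cos_diff inner_commute mult.commute)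
  show ?case unfolding * by (intro trigonometric_sum_sum trigonometric_sum.wave)
qed (auto intro: trigonometric_sum_const trigonometric_sum.add trigonometric_sum_mult)

lemma trigonometric_sum_props:
  assumes "trigonometric_sum f"
  shows "continuous_on UNIV f" "\<exists>B. \<forall>x. \<bar>f x\<bar> \<le> B"
proof -
  show "continuous_on UNIV f"
    using assms by induction (auto intro!: continuous_intros)
  show "\<exists>B. \<forall>x. \<bar>f x\<bar> \<le> B"
    using assms
  proof induction
    case (wave a t \<theta>)
    have "\<bar>a * cos (t \<bullet> x + \<theta>)\<bar> \<le> \<bar>a\<bar>" for x
      by (simp add: abs_mult mult_left_le)
    thus ?case by blast
  next
    case (add f g)
    then obtain B C where "\<forall>x. \<bar>f x\<bar> \<le> B" "\<forall>x. \<bar>g x\<bar> \<le> C" by blast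
    hence "\<forall>x. \<bar>f x + g x\<bar> \<le> B + C" by (meson abs_triangle_ineq add_mono order_trans)
    thus ?case by blast
  qed
qed

lemma (in prob_space) integrable_bounded_continuous:
  fixes f :: "'b::euclidean_space \<Rightarrow> real"
  assumes X: "X \<in> borel_measurable M" and f: "continuous_on UNIV f" "\<And>x. \<bar>f x\<bar> \<le> B"
  shows "integrable M (\<lambda>\<omega>. f (X \<omega>))"
proof (rule integrable_const_bound[where B = B])
  show "(\<lambda>\<omega>. f (X \<omega>)) \<in> borel_measurable M"
    using measurable_compose[OF X borel_measurable_continuous_onI[OF f(1)]] .
qed (use f in auto)

lemma (in prob_space) expectation_close:
  fixes f g :: "'a \<Rightarrow> real"
  assumes "integrable M f" "integrable M g" "integrable M h" "\<And>x. x \<in> space M \<Longrightarrow> \<bar>f x - g x\<bar> \<le> h x"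
  shows "\<bar>expectation f - expectation g\<bar> \<le> expectation h"
proof -
  have "\<bar>expectation f - expectation g\<bar> = \<bar>expectation (\<lambda>x. f x - g x)\<bar>"
    using assms by simp
  also have "\<dots> \<le> expectation (\<lambda>x. \<bar>f x - g x\<bar>)" by (rule integral_abs_bound)
  also have "\<dots> \<le> expectation h" using assms by (intro integral_mono) auto
  finally show ?thesis .
qed

text \<open>
  The coordinatewise triangle wave of period \<open>2 * pi * L\<close>: periodic and continuous, yet the identity on the
  box of half-width \<open>L\<close>. It makes a function periodic without altering it on a box.
\<close>
definition fold_box :: "real \<Rightarrow> 'b::euclidean_space \<Rightarrow> 'b" where
  "fold_box L x = (\<Sum>b\<in>Basis. (L * arcsin (sin ((x \<bullet> b) / L))) *\<^sub>R b)"

lemma fold_box_eq: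
  assumes "L > 0" "\<And>b. b \<in> Basis \<Longrightarrow> \<bar>x \<bullet> b\<bar> \<le> L"
  shows "fold_box L x = x"
proof -
  have "L * arcsin (sin ((x \<bullet> b) / L)) = x \<bullet> b" if "b \<in> Basis" for b
  proof -
    have "\<bar>(x \<bullet> b) / L\<bar> \<le> 1" using assms that by (simp add: abs_divide)
    hence "- (pi / 2) \<le> (x \<bullet> b) / L" "(x \<bullet> b) / L \<le> pi / 2"
      using pi_ge_two by linarith+
    thus ?thesis using assms(1) by (simp add: arcsin_sin)
  qed
  thus ?thesis unfolding fold_box_def by (simp add: euclidean_representation)
qed

lemma continuous_fold_box: "continuous_on UNIV (fold_box L)"
  unfolding fold_box_def divide_inverse by (intro continuous_intros) (auto simp: sin_ge_minus_one)

text \<open>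
  The folded function depends on \<open>x\<close> only through the sines of its coordinates, which lie in a
  cube, and it is continuous in them. The Stone-Weierstrass theorem on that cube gives a
  polynomial in these sines, hence an approximation that is uniform on the whole space.
\<close>
lemma fold_box_trigonometric_approximation:
  fixes f :: "'b::euclidean_space \<Rightarrow> real"
  assumes f: "continuous_on UNIV f" and e: "e > 0"
  obtains g where "trigonometric_sum g" "\<And>x. \<bar>f (fold_box L x) - g x\<bar> < e"
proof -
  define F where "F s = f (\<Sum>b\<in>Basis. (L * arcsin (s \<bullet> b)) *\<^sub>R b)" for s :: 'b
  have "continuous_on (cbox (- One) One) F"
    unfolding F_def
    by (intro continuous_on_compose2[OF f] continuous_intros) (auto simp: mem_box)
  then obtain p where p: "real_polynomial_function p"
      "\<And>s. s \<in> cbox (- One) One \<Longrightarrow> \<bar>F s - p s\<bar> < e"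
    using Stone_Weierstrass_real_polynomial_function[OF compact_cbox _ e] by metis
  let ?s = "\<lambda>x::'b. \<Sum>b\<in>Basis. sin ((x \<bullet> b) / L) *\<^sub>R b"
  have "?s x \<in> cbox (- One) One" for x by (auto simp: mem_box sin_ge_minus_one)
  moreover have "F (?s x) = f (fold_box L x)" for x by (simp add: F_def fold_box_def)
  ultimately have "\<bar>f (fold_box L x) - p (?s x)\<bar> < e" for x using p(2) by metis
  thus ?thesis using that trigonometric_sum_polynomial_of_sines[OF p(1)] by blast
qed

locale characteristic_convergence = Q: prob_space Q for Q :: "'d measure" +
  fixes P :: "nat \<Rightarrow> 'c measure" and X :: "nat \<Rightarrow> 'c \<Rightarrow> 'b::euclidean_space" and Y :: "'d \<Rightarrow> 'b"
  assumes prob_P: "\<And>n. prob_space (P n)"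
    and X: "\<And>n. X n \<in> borel_measurable (P n)" and Y: "Y \<in> borel_measurable Q"
    and conv: "\<And>t. (\<lambda>n. CLINT \<omega>|P n. iexp (t \<bullet> X n \<omega>)) \<longlonglongrightarrow> (CLINT \<omega>|Q. iexp (t \<bullet> Y \<omega>))"
begin

lemma trigonometric_sum_conv:
  assumes "trigonometric_sum f"
  shows "(\<lambda>n. integral\<^sup>L (P n) (\<lambda>\<omega>. f (X n \<omega>))) \<longlonglongrightarrow> Q.expectation (\<lambda>\<omega>. f (Y \<omega>))"
  using assms
proof induction
  case (wave a t \<theta>)
  have *: "integral\<^sup>L R (\<lambda>\<omega>. a * cos (t \<bullet> Z \<omega> + \<theta>)) =
      a * Re (iexp \<theta> * (CLINT \<omega>|R. iexp (t \<bullet> Z \<omega>)))"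
    if "prob_space R" and Z: "Z \<in> borel_measurable R" for R :: "'z measure" and Z :: "'z \<Rightarrow> 'b"
  proof -
    interpret prob_space R by fact
    have [measurable]: "(\<lambda>\<omega>. t \<bullet> Z \<omega>) \<in> borel_measurable R" using Z by measurable
    have int: "integrable R (\<lambda>\<omega>. iexp (t \<bullet> Z \<omega>))" by (rule integrable_iexp) auto
    have "iexp \<theta> * (CLINT \<omega>|R. iexp (t \<bullet> Z \<omega>)) = (CLINT \<omega>|R. iexp \<theta> * iexp (t \<bullet> Z \<omega>))"
      by simp
    hence "Re (iexp \<theta> * (CLINT \<omega>|R. iexp (t \<bullet> Z \<omega>))) = integral\<^sup>L R (\<lambda>\<omega>. Re (iexp \<theta> * iexp (t \<bullet> Z \<omega>)))"
      using integral_Re[OF integrable_mult_right[OF int, of "iexp \<theta>"]] by simp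
    also have "(\<lambda>\<omega>. Re (iexp \<theta> * iexp (t \<bullet> Z \<omega>))) = (\<lambda>\<omega>. cos (t \<bullet> Z \<omega> + \<theta>))"
      by (auto simp: fun_eq_iff Re_exp Im_exp cos_add mult.commute)
    finally show ?thesis by simp
  qed
  show ?case unfolding *[OF prob_P X] *[OF Q.prob_space_axioms Y] by (intro tendsto_intros conv)
next
  case (add f g)
  note props = trigonometric_sum_props[OF add(1)] trigonometric_sum_props[OF add(2)]
  from props obtain B C where B: "\<And>x. \<bar>f x\<bar> \<le> B" "\<And>x. \<bar>g x\<bar> \<le> C" by blast
  have "integrable (P n) (\<lambda>\<omega>. f (X n \<omega>))" "integrable (P n) (\<lambda>\<omega>. g (X n \<omega>))" for n
    using prob_space.integrable_bounded_continuous[OF prob_P X props(1) B(1)]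
      prob_space.integrable_bounded_continuous[OF prob_P X props(3) B(2)] by auto
  moreover have "integrable Q (\<lambda>\<omega>. f (Y \<omega>))" "integrable Q (\<lambda>\<omega>. g (Y \<omega>))"
    using Q.integrable_bounded_continuous[OF Y props(1) B(1)]
      Q.integrable_bounded_continuous[OF Y props(3) B(2)] by auto
  ultimately show ?case using tendsto_add[OF add(3,4)] by simp
qed

lemma fold_box_conv:
  fixes f :: "'b \<Rightarrow> real"
  assumes f: "continuous_on UNIV f" "\<And>x. \<bar>f x\<bar> \<le> B"
  shows "(\<lambda>n. integral\<^sup>L (P n) (\<lambda>\<omega>. f (fold_box L (X n \<omega>)))) \<longlonglongrightarrow> Q.expectation (\<lambda>\<omega>. f (fold_box L (Y \<omega>)))"
proof (rule LIMSEQ_I)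
  fix e :: real assume "e > 0"
  then obtain g where g: "trigonometric_sum g" "\<And>x. \<bar>f (fold_box L x) - g x\<bar> < e / 3"
    using fold_box_trigonometric_approximation[OF f(1), of "e / 3" L] by auto
  obtain C where C: "\<And>x. \<bar>g x\<bar> \<le> C" using trigonometric_sum_props[OF g(1)] by blast
  have fb: "continuous_on UNIV (\<lambda>x. f (fold_box L x))"
    using continuous_on_compose2[OF f(1) continuous_fold_box] by auto
  have near: "\<bar>integral\<^sup>L R (\<lambda>\<omega>. f (fold_box L (Z \<omega>))) - integral\<^sup>L R (\<lambda>\<omega>. g (Z \<omega>))\<bar> \<le> e / 3"
    if "prob_space R" and Z: "Z \<in> borel_measurable R" for R :: "'z measure" and Z
  proof -
    interpret prob_space R by fact
    have "\<bar>integral\<^sup>L R (\<lambda>\<omega>. f (fold_box L (Z \<omega>))) - integral\<^sup>L R (\<lambda>\<omega>. g (Z \<omega>))\<bar>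
        \<le> integral\<^sup>L R (\<lambda>_. e / 3)"
      using integrable_bounded_continuous[OF Z fb f(2)]
        integrable_bounded_continuous[OF Z trigonometric_sum_props(1)[OF g(1)] C] g(2)
      by (intro expectation_close) (auto intro: less_imp_le)
    thus ?thesis by (simp add: prob_space)
  qed
  from \<open>e > 0\<close> LIMSEQ_D[OF trigonometric_sum_conv[OF g(1)], of "e / 3"] obtain N where
    N: "\<And>n. n \<ge> N \<Longrightarrow> \<bar>integral\<^sup>L (P n) (\<lambda>\<omega>. g (X n \<omega>)) - Q.expectation (\<lambda>\<omega>. g (Y \<omega>))\<bar> < e / 3"
    by auto
  have "norm (integral\<^sup>L (P n) (\<lambda>\<omega>. f (fold_box L (X n \<omega>))) - Q.expectation (\<lambda>\<omega>. f (fold_box L (Y \<omega>)))) < e"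
    if "n \<ge> N" for n
    using N[OF that] near[OF prob_P X, of n] near[OF Q.prob_space_axioms Y] unfolding real_norm_def
    by linarith
  thus "\<exists>N. \<forall>n\<ge>N. norm (integral\<^sup>L (P n) (\<lambda>\<omega>. f (fold_box L (X n \<omega>)))
      - Q.expectation (\<lambda>\<omega>. f (fold_box L (Y \<omega>)))) < e" by blast
qed

  text \<open>
    A bounded continuous function that is at least \<open>1\<close> outside the box of half-width \<open>L + 1\<close>; its
    expectation bounds the mass escaping from that box. It is a sum over coordinates, so its
    convergence follows from the one-dimensional continuity theorem.
  \<close>
definition excess :: "real \<Rightarrow> 'b \<Rightarrow> real" where
  "excess L x = (\<Sum>b\<in>Basis. min 1 (max 0 (\<bar>b \<bullet> x\<bar> - L)))"

lemma excess_bounds: "0 \<le> excess L x" "\<bar>excess L x\<bar> \<le> real DIM('b)"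
proof -
  show "0 \<le> excess L x" unfolding excess_def by (intro sum_nonneg) auto
  moreover have "excess L x \<le> (\<Sum>b\<in>(Basis::'b set). 1)" unfolding excess_def by (intro sum_mono) auto
  ultimately show "\<bar>excess L x\<bar> \<le> real DIM('b)" by simp
qed

lemma continuous_excess: "continuous_on UNIV (excess L)"
  unfolding excess_def by (intro continuous_intros)

lemma excess_conv:
  "(\<lambda>n. integral\<^sup>L (P n) (\<lambda>\<omega>. excess L (X n \<omega>))) \<longlonglongrightarrow> Q.expectation (\<lambda>\<omega>. excess L (Y \<omega>))"
proof -
  have [measurable]: "(\<lambda>\<omega>. b \<bullet> X n \<omega>) \<in> borel_measurable (P n)" "(\<lambda>\<omega>. b \<bullet> Y \<omega>) \<in> borel_measurable Q" for n b
    using X[of n] Y by measurable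
  let ?k = "\<lambda>y::real. min 1 (max 0 (\<bar>y\<bar> - L))"
  have "(\<lambda>n. integral\<^sup>L (P n) (\<lambda>\<omega>. ?k (b \<bullet> X n \<omega>))) \<longlonglongrightarrow> Q.expectation (\<lambda>\<omega>. ?k (b \<bullet> Y \<omega>))" for b
  proof -
    have rP: "real_distribution (distr (P n) borel (\<lambda>\<omega>. b \<bullet> X n \<omega>))" for n
      by (intro prob_space.real_distribution_distr prob_P) simp
    have rQ: "real_distribution (distr Q borel (\<lambda>\<omega>. b \<bullet> Y \<omega>))"
      by (intro Q.real_distribution_distr) simp
    have "weak_conv_m (\<lambda>n. distr (P n) borel (\<lambda>\<omega>. b \<bullet> X n \<omega>)) (distr Q borel (\<lambda>\<omega>. b \<bullet> Y \<omega>))"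
      by (intro levy_continuity rP rQ) (use conv[of "s *\<^sub>R b" for s] in \<open>simp add: char_def integral_distr\<close>)
    hence "(\<lambda>n. integral\<^sup>L (distr (P n) borel (\<lambda>\<omega>. b \<bullet> X n \<omega>)) ?k)
        \<longlonglongrightarrow> integral\<^sup>L (distr Q borel (\<lambda>\<omega>. b \<bullet> Y \<omega>)) ?k"
      by (intro weak_conv_imp_integral_bdd_continuous_conv[where B = 1] rP rQ)
         (auto intro!: continuous_intros)
    thus ?thesis by (simp add: integral_distr)
  qed
  hence "(\<lambda>n. \<Sum>b\<in>Basis. integral\<^sup>L (P n) (\<lambda>\<omega>. ?k (b \<bullet> X n \<omega>))) \<longlonglongrightarrow>
      (\<Sum>b\<in>Basis. Q.expectation (\<lambda>\<omega>. ?k (b \<bullet> Y \<omega>)))"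
    by (intro tendsto_sum)
  moreover have "integrable Q (\<lambda>\<omega>. ?k (b \<bullet> Y \<omega>))" for b
    by (rule Q.integrable_const_bound[where B = 1]) auto
  moreover have "integrable (P n) (\<lambda>\<omega>. ?k (b \<bullet> X n \<omega>))" for b n
  proof -
    interpret prob_space "P n" by (rule prob_P)
    show ?thesis by (rule integrable_const_bound[where B = 1]) auto
  qed
  ultimately show ?thesis unfolding excess_def by (simp add: Bochner_Integration.integral_sum)
qed

lemma excess_vanishes: "(\<lambda>l. Q.expectation (\<lambda>\<omega>. excess (real l) (Y \<omega>))) \<longlonglongrightarrow> 0"
proof -
  have m: "(\<lambda>\<omega>. excess L (Y \<omega>)) \<in> borel_measurable Q" for L
    using measurable_compose[OF Y borel_measurable_continuous_onI[OF continuous_excess]] .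
  have "(\<lambda>l. excess (real l) x) \<longlonglongrightarrow> 0" for x
  proof (rule tendsto_eventually)
    have "\<forall>\<^sub>F l in sequentially. norm x \<le> real l"
      using filterlim_real_sequentially by (simp add: filterlim_at_top)
    thus "\<forall>\<^sub>F l in sequentially. excess (real l) x = 0"
    proof eventually_elim
      case (elim l)
      have "\<bar>b \<bullet> x\<bar> \<le> real l" if "b \<in> Basis" for b
        using Basis_le_norm[OF that, of x] elim by (simp add: inner_commute)
      thus ?case unfolding excess_def by (intro sum.neutral) auto
    qed
  qed
  hence "(\<lambda>l. Q.expectation (\<lambda>\<omega>. excess (real l) (Y \<omega>))) \<longlonglongrightarrow> Q.expectation (\<lambda>\<omega>. 0)"
    using m excess_bounds(2) by (intro integral_dominated_convergence[where w = "\<lambda>_. real DIM('b)"]) auto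
  thus ?thesis by simp
qed

  text \<open>
    On a large box the test function agrees with its folded version, whose expectations converge by
    trigonometric approximation; outside the box the error is bounded by \<open>excess\<close>, whose expectations
    are eventually small.
  \<close>
theorem bounded_continuous_conv:
  fixes f :: "'b \<Rightarrow> real"
  assumes f: "continuous_on UNIV f" "\<And>x. \<bar>f x\<bar> \<le> B"
  shows "(\<lambda>n. integral\<^sup>L (P n) (\<lambda>\<omega>. f (X n \<omega>))) \<longlonglongrightarrow> Q.expectation (\<lambda>\<omega>. f (Y \<omega>))"
proof (rule LIMSEQ_I)
  fix e :: real assume e: "e > 0"
  have B0: "B \<ge> 0" using f(2)[of 0] by linarith
  define d where "d = e / (6 * (B + 1))"
  have "d > 0" using e B0 by (simp add: d_def)
  moreover have "6 * (B + 1) * d = e" using B0 by (simp add: d_def)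
  ultimately have d: "d > 0" "4 * (B * d) < e"
    using mult_nonneg_nonneg[OF B0, of d] by (simp_all add: algebra_simps)
  from LIMSEQ_D[OF excess_vanishes d(1)] obtain l where "\<bar>Q.expectation (\<lambda>\<omega>. excess (real l) (Y \<omega>))\<bar> < d"
    by auto
  define L where "L = real l + 1"
  have exQ: "Q.expectation (\<lambda>\<omega>. excess (real l) (Y \<omega>)) < d" using \<open>\<bar>_\<bar> < d\<close> by linarith
  have fb: "continuous_on UNIV (\<lambda>x. f (fold_box L x))"
    using continuous_on_compose2[OF f(1) continuous_fold_box] by auto
  have pt: "\<bar>f x - f (fold_box L x)\<bar> \<le> 2 * B * excess (real l) x" for x
  proof (cases "\<forall>b\<in>Basis. \<bar>x \<bullet> b\<bar> \<le> L")
    case True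
    hence "fold_box L x = x" by (intro fold_box_eq) (auto simp: L_def)
    thus ?thesis using B0 excess_bounds(1) by simp
  next
    case False
    then obtain b where b: "b \<in> Basis" "\<bar>b \<bullet> x\<bar> > L" by (auto simp: inner_commute not_le)
    have "1 = min 1 (max 0 (\<bar>b \<bullet> x\<bar> - real l))" using b by (auto simp: L_def)
    also have "\<dots> \<le> excess (real l) x" unfolding excess_def using b by (intro member_le_sum) auto
    finally have "2 * B * 1 \<le> 2 * B * excess (real l) x" using B0 by (intro mult_left_mono) auto
    thus ?thesis using f(2)[of x] f(2)[of "fold_box L x"] by linarith
  qed
  have near: "\<bar>integral\<^sup>L R (\<lambda>\<omega>. f (Z \<omega>)) - integral\<^sup>L R (\<lambda>\<omega>. f (fold_box L (Z \<omega>)))\<bar>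
      \<le> 2 * B * integral\<^sup>L R (\<lambda>\<omega>. excess (real l) (Z \<omega>))"
    if "prob_space R" and Z: "Z \<in> borel_measurable R" for R :: "'z measure" and Z
  proof -
    interpret prob_space R by fact
    have "\<bar>integral\<^sup>L R (\<lambda>\<omega>. f (Z \<omega>)) - integral\<^sup>L R (\<lambda>\<omega>. f (fold_box L (Z \<omega>)))\<bar>
        \<le> integral\<^sup>L R (\<lambda>\<omega>. 2 * B * excess (real l) (Z \<omega>))"
      using integrable_bounded_continuous[OF Z f] integrable_bounded_continuous[OF Z fb f(2)]
        integrable_bounded_continuous[OF Z continuous_excess excess_bounds(2)] pt
      by (intro expectation_close) auto
    thus ?thesis by simp
  qed
  note step = near[OF prob_P X] near[OF Q.prob_space_axioms Y]
  have "\<forall>\<^sub>F n in sequentially. integral\<^sup>L (P n) (\<lambda>\<omega>. excess (real l) (X n \<omega>)) < d"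
    using order_tendstoD(2)[OF excess_conv exQ] .
  moreover have "\<forall>\<^sub>F n in sequentially. \<bar>integral\<^sup>L (P n) (\<lambda>\<omega>. f (fold_box L (X n \<omega>)))
      - Q.expectation (\<lambda>\<omega>. f (fold_box L (Y \<omega>)))\<bar> < e - 4 * (B * d)"
    using tendstoD[OF fold_box_conv[OF f, of L], of "e - 4 * (B * d)"] d by (auto simp: dist_real_def)
  ultimately have "\<forall>\<^sub>F n in sequentially. norm (integral\<^sup>L (P n) (\<lambda>\<omega>. f (X n \<omega>)) - Q.expectation (\<lambda>\<omega>. f (Y \<omega>))) < e"
  proof eventually_elim
    case (elim n)
    have "2 * B * integral\<^sup>L (P n) (\<lambda>\<omega>. excess (real l) (X n \<omega>)) \<le> 2 * B * d"
      "2 * B * Q.expectation (\<lambda>\<omega>. excess (real l) (Y \<omega>)) \<le> 2 * B * d"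
      using elim(1) exQ B0 by (intro mult_left_mono; simp)+
    thus ?case using step(1)[of n] step(2) elim(2) unfolding real_norm_def by argo
  qed
  thus "\<exists>N. \<forall>n\<ge>N. norm (integral\<^sup>L (P n) (\<lambda>\<omega>. f (X n \<omega>)) - Q.expectation (\<lambda>\<omega>. f (Y \<omega>))) < e"
    by (simp add: eventually_sequentially)
qed

end

section \<open>Sums of independent identically distributed vectors\<close>

lemma expectation_bind_finite:
  fixes h :: "'b \<Rightarrow> 'c::{banach, second_countable_topology}"
  assumes "finite (set_pmf p)" "\<And>x. x \<in> set_pmf p \<Longrightarrow> finite (set_pmf (f x))"
  shows "measure_pmf.expectation (bind_pmf p f) h =
    measure_pmf.expectation p (\<lambda>x. measure_pmf.expectation (f x) h)"
  using pmf_expectation_bind[OF assms(1,2) order_refl]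
    integral_measure_pmf[OF assms(1), of p "\<lambda>x. measure_pmf.expectation (f x) h"] by simp

primrec iid_sum :: "'b::comm_monoid_add pmf \<Rightarrow> nat \<Rightarrow> 'b pmf" where
  "iid_sum p 0 = return_pmf 0"
| "iid_sum p (Suc m) = bind_pmf p (\<lambda>x. map_pmf (\<lambda>y. x + y) (iid_sum p m))"

lemma finite_iid_sum: "finite (set_pmf p) \<Longrightarrow> finite (set_pmf (iid_sum p m))"
  by (induction m) auto

lemma expectation_iid_sum_Suc:
  fixes h :: "'b::comm_monoid_add \<Rightarrow> 'c::{banach, second_countable_topology}"
  assumes "finite (set_pmf p)"
  shows "measure_pmf.expectation (iid_sum p (Suc m)) h =
    measure_pmf.expectation p (\<lambda>x. measure_pmf.expectation (iid_sum p m) (\<lambda>y. h (x + y)))"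
  using assms by (simp add: expectation_bind_finite finite_iid_sum)

lemma characteristic_function_iid_sum:
  fixes p :: "'b::euclidean_space pmf"
  assumes "finite (set_pmf p)"
  shows "(CLINT x|iid_sum p m. iexp (t \<bullet> x)) = (CLINT x|p. iexp (t \<bullet> x)) ^ m"
proof (induction m)
  case (Suc m)
  have "(CLINT x|iid_sum p (Suc m). iexp (t \<bullet> x)) =
      (CLINT x|p. CLINT y|iid_sum p m. iexp (t \<bullet> x) * iexp (t \<bullet> y))"
    unfolding expectation_iid_sum_Suc[OF assms] by (simp add: inner_add_right distrib_left exp_add)
  thus ?case using Suc by simp
qed simp

lemma second_moment_iid_sum:
  fixes p :: "'b::euclidean_space pmf"
  assumes fin: "finite (set_pmf p)" and mean: "measure_pmf.expectation p (\<lambda>x. x) = 0"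
  shows "measure_pmf.expectation (iid_sum p m) (\<lambda>x. (norm x)\<^sup>2) =
    real m * measure_pmf.expectation p (\<lambda>x. (norm x)\<^sup>2)"
proof (induction m)
  case (Suc m)
  let ?E = "measure_pmf.expectation p" and ?F = "measure_pmf.expectation (iid_sum p m)"
  have int: "integrable p g" "integrable (iid_sum p m) k"
    for g k :: "'b \<Rightarrow> 'd::{banach, second_countable_topology}"
    using fin by (auto intro: integrable_measure_pmf_finite finite_iid_sum)
  have "(norm (x + y))\<^sup>2 = (norm x)\<^sup>2 + 2 * (x \<bullet> y) + (norm y)\<^sup>2" for x y :: 'b
    by (simp add: power2_norm_eq_inner inner_add_left inner_add_right inner_commute)
  hence "measure_pmf.expectation (iid_sum p (Suc m)) (\<lambda>x. (norm x)\<^sup>2) =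
      ?E (\<lambda>x. (norm x)\<^sup>2 + 2 * (x \<bullet> ?F (\<lambda>y. y)) + ?F (\<lambda>y. (norm y)\<^sup>2))"
    unfolding expectation_iid_sum_Suc[OF fin] by (simp add: int)
  also have "\<dots> = ?E (\<lambda>x. (norm x)\<^sup>2) + 2 * (?E (\<lambda>x. x) \<bullet> ?F (\<lambda>y. y)) + ?F (\<lambda>y. (norm y)\<^sup>2)"
    by (simp add: int)
  finally show ?case using Suc mean by (simp add: algebra_simps)
qed simp

text \<open>
  The usual expansion of the characteristic function. Its remainder is of order \<open>1 / n powr (3 / 2)\<close>
  because the steps are bounded. No direction \<open>t\<close> is excluded: the variance along \<open>t\<close> may vanish, as it does
  for steps confined to a hyperplane.
\<close>
theorem characteristic_function_clt:
  fixes p :: "'b::euclidean_space pmf"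
  assumes fin: "finite (set_pmf p)" and mean: "measure_pmf.expectation p (\<lambda>x. x) = 0"
  shows "(\<lambda>n. CLINT x|iid_sum p n. iexp ((t \<bullet> x) / sqrt (real n))) \<longlonglongrightarrow>
    complex_of_real (exp (- measure_pmf.expectation p (\<lambda>x. (t \<bullet> x)\<^sup>2) / 2))"
proof -
  define v where "v = measure_pmf.expectation p (\<lambda>x. (t \<bullet> x)\<^sup>2)"
  define C where "C = measure_pmf.expectation p (\<lambda>x. \<bar>t \<bullet> x\<bar> ^ 3)"
  define \<psi> where "\<psi> n = (CLINT x|p. iexp ((t \<bullet> x) / sqrt (real n)))" for n
  have int: "integrable p g" for g :: "'b \<Rightarrow> 'd::{banach, second_countable_topology}"
    using fin by (rule integrable_measure_pmf_finite)
  have mean_t: "measure_pmf.expectation p (\<lambda>x. t \<bullet> x) = 0"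
    using mean integral_inner_right[OF int, of t "\<lambda>x. x"] by simp
  have v0: "v \<ge> 0" unfolding v_def by simp
  have eq: "(CLINT x|iid_sum p n. iexp ((t \<bullet> x) / sqrt (real n))) = \<psi> n ^ n" for n
    using characteristic_function_iid_sum[OF fin, of n "t /\<^sub>R sqrt (real n)"]
    by (simp add: \<psi>_def divide_inverse mult.commute)
  have bound: "norm (\<psi> n ^ n - complex_of_real ((1 + (- v / 2) / n) ^ n)) \<le> C / sqrt (real n)"
    if n: "real n \<ge> v" "n > 0" for n
  proof -
    let ?s = "1 / sqrt (real n)"
    have "norm (char (distr p borel (\<lambda>x. t \<bullet> x)) ?s - (1 - ?s\<^sup>2 * v / 2)) \<le>
        ?s\<^sup>2 / 6 * measure_pmf.expectation p (\<lambda>x. min (6 * (t \<bullet> x)\<^sup>2) (\<bar>?s\<bar> * \<bar>t \<bullet> x\<bar> ^ 3))"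
      by (rule prob_space.char_approx3'[OF prob_space_measure_pmf]) (auto simp: int mean_t v_def)
    also have "\<dots> \<le> ?s\<^sup>2 / 6 * measure_pmf.expectation p (\<lambda>x. \<bar>?s\<bar> * \<bar>t \<bullet> x\<bar> ^ 3)"
      by (intro mult_left_mono integral_mono int) auto
    also have "\<dots> \<le> ?s\<^sup>2 * (?s * C)" unfolding C_def using n by (simp add: divide_simps)
    also have "char (distr p borel (\<lambda>x. t \<bullet> x)) ?s = \<psi> n"
      by (simp add: char_def integral_distr \<psi>_def)
    finally have *: "norm (\<psi> n - complex_of_real (1 + (- v / 2) / n)) \<le> ?s\<^sup>2 * (?s * C)"
      using n by (simp add: power_divide mult.commute)
    have "norm (\<psi> n) \<le> measure_pmf.expectation p (\<lambda>x. norm (iexp ((t \<bullet> x) / sqrt (real n))))"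
      unfolding \<psi>_def by (rule integral_norm_bound)
    hence "norm (\<psi> n) \<le> 1" by (simp del: of_real_divide)
    moreover have "\<bar>1 + (- v / 2) / n\<bar> \<le> 1" using v0 n by (auto simp: abs_le_iff field_simps)
    ultimately have "norm (\<psi> n ^ n - complex_of_real (1 + (- v / 2) / n) ^ n) \<le>
        real n * norm (\<psi> n - complex_of_real (1 + (- v / 2) / n))"
      by (intro norm_power_diff) (auto simp del: of_real_add of_real_diff)
    also have "\<dots> \<le> real n * (?s\<^sup>2 * (?s * C))" by (intro mult_left_mono *) simp
    also have "\<dots> = C / sqrt (real n)" using n by (simp add: power_divide)
    finally show ?thesis by simp
  qed
  have "(\<lambda>n. C / sqrt (real n)) \<longlonglongrightarrow> 0"
    by (intro real_tendsto_divide_at_top[OF tendsto_const]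
      filterlim_compose[OF sqrt_at_top filterlim_real_sequentially])
  moreover have "\<forall>\<^sub>F n in sequentially. norm (\<psi> n ^ n - complex_of_real ((1 + (- v / 2) / n) ^ n)) \<le> C / sqrt (real n)"
    using eventually_gt_at_top[of 0] filterlim_real_sequentially[unfolded filterlim_at_top, THEN spec, of v]
    by eventually_elim (rule bound)
  ultimately have "(\<lambda>n. \<psi> n ^ n - complex_of_real ((1 + (- v / 2) / n) ^ n)) \<longlonglongrightarrow> 0"
    by (rule Lim_null_comparison[rotated])
  moreover have "(\<lambda>n. complex_of_real ((1 + (- v / 2) / n) ^ n)) \<longlonglongrightarrow> complex_of_real (exp (- v / 2))"
    by (rule isCont_tendsto_compose[OF _ tendsto_exp_limit_sequentially]) auto
  ultimately have "(\<lambda>n. \<psi> n ^ n) \<longlonglongrightarrow> complex_of_real (exp (- v / 2))"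
    by (rule Lim_transform[rotated])
  thus ?thesis unfolding eq v_def .
qed

section \<open>Weak convergence with bounded moments\<close>

definition clamp_to :: "real \<Rightarrow> real \<Rightarrow> real" where
  "clamp_to R x = max (- R) (min R x)"

text \<open>
  Truncation at \<open>R\<close> changes a power by at most a higher even power divided by \<open>R\<close>, so bounded even
  moments make the truncation error small uniformly in the measure.
\<close>
lemma clamp_to_power_error:
  assumes "R \<ge> 1"
  shows "\<bar>x ^ k - clamp_to R x ^ k\<bar> \<le> x ^ (2 * (k + 1)) / R"
proof (cases "\<bar>x\<bar> \<le> R")
  case True
  hence "clamp_to R x = x" by (auto simp: clamp_to_def)
  moreover have "0 \<le> x ^ (2 * (k + 1))" by (rule zero_le_even_power) simp
  ultimately show ?thesis using assms by (simp del: power_Suc)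
next
  case False
  define s :: real where "s = sgn x"
  have s: "x = s * \<bar>x\<bar>" "clamp_to R x = s * R" "\<bar>s\<bar> = 1"
    using False assms by (auto simp: s_def clamp_to_def sgn_if)
  have "\<bar>x ^ k - clamp_to R x ^ k\<bar> = \<bar>s ^ k * (\<bar>x\<bar> ^ k - R ^ k)\<bar>"
    by (subst s(1), subst s(2)) (simp add: power_mult_distrib right_diff_distrib)
  also have "\<dots> = \<bar>x\<bar> ^ k - R ^ k"
    using s(3) False assms power_mono[of R "\<bar>x\<bar>" k] by (simp add: abs_mult power_abs)
  also have "\<dots> \<le> \<bar>x\<bar> ^ k" using assms by simp
  also have "\<dots> \<le> \<bar>x\<bar> ^ (2 * k + 1) * (\<bar>x\<bar> / R)"
  proof -
    have "\<bar>x\<bar> ^ k * 1 \<le> \<bar>x\<bar> ^ (2 * k + 1) * (\<bar>x\<bar> / R)"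
      using False assms by (intro mult_mono power_increasing) auto
    thus ?thesis by simp
  qed
  also have "\<dots> = x ^ (2 * (k + 1)) / R"
    using power_even_abs[of "2 * (k + 1)" x] by (simp add: mult.assoc mult.commute)
  finally show ?thesis .
qed

lemma clamp_to_even_power_le:
  assumes "R \<ge> 0"
  shows "clamp_to R x ^ (2 * k) \<le> x ^ (2 * k)"
proof -
  have "\<bar>clamp_to R x\<bar> \<le> \<bar>x\<bar>" using assms by (auto simp: clamp_to_def)
  hence "\<bar>clamp_to R x\<bar> ^ (2 * k) \<le> \<bar>x\<bar> ^ (2 * k)" by (intro power_mono) auto
  thus "clamp_to R x ^ (2 * k) \<le> x ^ (2 * k)" by (simp add: power_even_abs)
qed

lemma power_le_one_plus_even_power: "\<bar>x ^ k\<bar> \<le> 1 + x ^ (2 * k)" for x :: real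
proof -
  have "0 \<le> (\<bar>x ^ k\<bar> - 1)\<^sup>2" by simp
  hence "2 * \<bar>x ^ k\<bar> \<le> 1 + (x ^ k)\<^sup>2" by (simp add: power2_diff)
  moreover have "(x ^ k)\<^sup>2 = x ^ (2 * k)" by (simp add: power_mult mult.commute flip: power_mult)
  ultimately show ?thesis by linarith
qed

locale weak_convergence_bounded_moments = M: real_distribution M for M :: "real measure" +
  fixes N :: "nat \<Rightarrow> real measure" and C :: "nat \<Rightarrow> real"
  assumes N: "\<And>n. real_distribution (N n)"
    and weak: "weak_conv_m N M"
    and int_N: "\<And>n k. integrable (N n) (\<lambda>x. x ^ k)"
    and bound: "\<And>n k. integral\<^sup>L (N n) (\<lambda>x. x ^ (2 * k)) \<le> C k"
begin

lemma clamp_to_power_integrable: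
  assumes "real_distribution P" "R \<ge> 0"
  shows "integrable P (\<lambda>x. clamp_to R x ^ k)"
proof -
  interpret real_distribution P by fact
  have "\<bar>clamp_to R x\<bar> ^ k \<le> R ^ k" for x using assms(2) by (intro power_mono) (auto simp: clamp_to_def)
  thus ?thesis unfolding clamp_to_def
    by (intro integrable_const_bound[where B = "R ^ k"]) (auto simp: power_abs)
qed

lemma clamp_to_power_conv:
  assumes "R \<ge> 0"
  shows "(\<lambda>n. integral\<^sup>L (N n) (\<lambda>x. clamp_to R x ^ k)) \<longlonglongrightarrow> M.expectation (\<lambda>x. clamp_to R x ^ k)"
proof (rule weak_conv_imp_integral_bdd_continuous_conv[where B = "R ^ k"])
  show "norm (clamp_to R x ^ k) \<le> R ^ k" for x
    unfolding norm_power using assms by (intro power_mono) (auto simp: clamp_to_def)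
  show "isCont (\<lambda>x. clamp_to R x ^ k) x" for x
    unfolding clamp_to_def by (intro continuous_intros)
qed (auto intro: N weak M.real_distribution_axioms)

  text \<open>
    Fatou's lemma: truncated even moments converge, so they inherit the bound, and the truncation is
    then removed.
  \<close>
lemma even_moment:
  shows even_moment_integrable: "integrable M (\<lambda>x. x ^ (2 * k))"
    and even_moment_le: "M.expectation (\<lambda>x. x ^ (2 * k)) \<le> C k"
proof -
  have le: "M.expectation (\<lambda>x. clamp_to (real j) x ^ (2 * k)) \<le> C k" for j
  proof (rule LIMSEQ_le_const2[OF clamp_to_power_conv], simp, intro exI allI impI)
    fix n
    have "integral\<^sup>L (N n) (\<lambda>x. clamp_to (real j) x ^ (2 * k)) \<le> integral\<^sup>L (N n) (\<lambda>x. x ^ (2 * k))"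
      by (intro integral_mono clamp_to_power_integrable N int_N clamp_to_even_power_le) auto
    thus "integral\<^sup>L (N n) (\<lambda>x. clamp_to (real j) x ^ (2 * k)) \<le> C k" using bound[of n k] by linarith
  qed
  have lim: "(\<lambda>j. clamp_to (real j) x ^ (2 * k)) \<longlonglongrightarrow> x ^ (2 * k)" for x
  proof (rule tendsto_eventually)
    have "\<forall>\<^sub>F j in sequentially. \<bar>x\<bar> \<le> real j"
      using filterlim_real_sequentially by (simp add: filterlim_at_top)
    thus "\<forall>\<^sub>F j in sequentially. clamp_to (real j) x ^ (2 * k) = x ^ (2 * k)"
      by eventually_elim (simp add: clamp_to_def)
  qed
  have "(\<integral>\<^sup>+x. ennreal (x ^ (2 * k)) \<partial>M) = (\<integral>\<^sup>+x. liminf (\<lambda>j. ennreal (clamp_to (real j) x ^ (2 * k))) \<partial>M)"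
    by (intro nn_integral_cong lim_imp_Liminf[symmetric] tendsto_ennrealI lim) simp
  also have "\<dots> \<le> liminf (\<lambda>j. \<integral>\<^sup>+x. ennreal (clamp_to (real j) x ^ (2 * k)) \<partial>M)"
    by (intro nn_integral_liminf) (simp add: clamp_to_def)
  also have "\<dots> \<le> liminf (\<lambda>j::nat. ennreal (C k))"
  proof (intro Liminf_mono always_eventually allI)
    fix j
    have "(\<integral>\<^sup>+x. ennreal (clamp_to (real j) x ^ (2 * k)) \<partial>M) =
        ennreal (M.expectation (\<lambda>x. clamp_to (real j) x ^ (2 * k)))"
      by (intro nn_integral_eq_integral clamp_to_power_integrable M.real_distribution_axioms) auto
    thus "(\<integral>\<^sup>+x. ennreal (clamp_to (real j) x ^ (2 * k)) \<partial>M) \<le> ennreal (C k)"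
      using le by (simp add: ennreal_leI)
  qed
  also have "\<dots> = ennreal (C k)" by (simp add: Liminf_const)
  finally have *: "(\<integral>\<^sup>+x. ennreal (x ^ (2 * k)) \<partial>M) \<le> ennreal (C k)" .
  show int: "integrable M (\<lambda>x. x ^ (2 * k))"
    by (rule integrableI_nonneg) (use * in \<open>auto intro: le_less_trans\<close>)
  have "ennreal (M.expectation (\<lambda>x. x ^ (2 * k))) \<le> ennreal (C k)"
    using * nn_integral_eq_integral[OF int] by simp
  moreover have "0 \<le> integral\<^sup>L (N 0) (\<lambda>x. x ^ (2 * k))" by (intro integral_nonneg_AE) simp
  ultimately show "M.expectation (\<lambda>x. x ^ (2 * k)) \<le> C k"
    using bound[of 0 k] by (simp add: ennreal_le_iff)
qed

lemma moment_integrable: "integrable M (\<lambda>x. x ^ k)"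
proof (rule Bochner_Integration.integrable_bound)
  show "integrable M (\<lambda>x. 1 + x ^ (2 * k))" using even_moment_integrable by simp
  show "AE x in M. norm (x ^ k) \<le> norm (1 + x ^ (2 * k))"
    using power_le_one_plus_even_power by (auto intro: order_trans)
qed simp

theorem moment_conv: "(\<lambda>n. integral\<^sup>L (N n) (\<lambda>x. x ^ k)) \<longlonglongrightarrow> M.expectation (\<lambda>x. x ^ k)"
proof (rule LIMSEQ_I)
  fix e :: real assume e: "e > 0"
  define D where "D = \<bar>C (k + 1)\<bar>"
  define R where "R = max 1 (3 * D / e + 1)"
  have R: "R \<ge> 1" by (simp add: R_def)
  have "3 * D / e < R" by (simp add: R_def)
  hence DR: "D / R < e / 3" using e R by (simp add: field_simps)
  have near: "\<bar>integral\<^sup>L P (\<lambda>x. x ^ k) - integral\<^sup>L P (\<lambda>x. clamp_to R x ^ k)\<bar> < e / 3"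
    if P: "real_distribution P" "\<And>k. integrable P (\<lambda>x. x ^ k)" "integral\<^sup>L P (\<lambda>x. x ^ (2 * (k + 1))) \<le> C (k + 1)" for P
  proof -
    have "\<bar>integral\<^sup>L P (\<lambda>x. x ^ k) - integral\<^sup>L P (\<lambda>x. clamp_to R x ^ k)\<bar> =
        \<bar>integral\<^sup>L P (\<lambda>x. x ^ k - clamp_to R x ^ k)\<bar>"
      using P(2) clamp_to_power_integrable[OF P(1)] R by simp
    also have "\<dots> \<le> integral\<^sup>L P (\<lambda>x. \<bar>x ^ k - clamp_to R x ^ k\<bar>)" by (rule integral_abs_bound)
    also have "\<dots> \<le> integral\<^sup>L P (\<lambda>x. x ^ (2 * (k + 1)) / R)"
    proof (rule integral_mono)
      show "integrable P (\<lambda>x. \<bar>x ^ k - clamp_to R x ^ k\<bar>)"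
        using P(2) clamp_to_power_integrable[OF P(1)] R by simp
      show "integrable P (\<lambda>x. x ^ (2 * (k + 1)) / R)" using P(2)[of "2 * (k + 1)"] by simp
    qed (rule clamp_to_power_error[OF R])
    also have "\<dots> = integral\<^sup>L P (\<lambda>x. x ^ (2 * (k + 1))) / R" by simp
    also have "\<dots> \<le> D / R" using P(3) R by (intro divide_right_mono) (auto simp: D_def)
    finally show ?thesis using DR by linarith
  qed
  from LIMSEQ_D[OF clamp_to_power_conv[of R k], of "e / 3"] R e obtain n0 where n0:
    "\<And>n. n \<ge> n0 \<Longrightarrow> \<bar>integral\<^sup>L (N n) (\<lambda>x. clamp_to R x ^ k) - M.expectation (\<lambda>x. clamp_to R x ^ k)\<bar> < e / 3"
    by auto
  have "norm (integral\<^sup>L (N n) (\<lambda>x. x ^ k) - M.expectation (\<lambda>x. x ^ k)) < e" if "n \<ge> n0" for n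
    using n0[OF that] near[OF N int_N bound, of n]
      near[OF M.real_distribution_axioms moment_integrable even_moment_le]
    unfolding real_norm_def by linarith
  thus "\<exists>n0. \<forall>n\<ge>n0. norm (integral\<^sup>L (N n) (\<lambda>x. x ^ k) - M.expectation (\<lambda>x. x ^ k)) < e" by blast
qed

end

section \<open>The greedy game as a recursion on the remaining moves\<close>

text \<open>
  The joint law of a greedy round, as a function of the available moves alone.
\<close>
definition greedy_round :: "move set \<Rightarrow> (move \<times> move) pmf" where
  "greedy_round A = pair_pmf
     (if A = UNIV then pmf_of_set UNIV
      else if card A = 2 then
        (let i = (THE i. A = {i, i + 1}) in
           map_pmf (\<lambda>b. if b then i else i + 1) (bernoulli_pmf (1 / 3)))
      else return_pmf (the_elem A))
     (if A = UNIV then pmf_of_set UNIV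
      else if card A = 2 then
        (let i = (THE i. A = {i, i + 1}) in
           map_pmf (\<lambda>b. if b then i + 1 else i + 2) (bernoulli_pmf (2 / 3)))
      else return_pmf (the_elem A + 1))"

lemma greedy_round_available:
  "pair_pmf (greedy_R n h) (greedy_N n h) = greedy_round (available n h)"
  unfolding greedy_round_def greedy_R_def greedy_N_def Let_def ..

definition use_move :: "(move \<Rightarrow> nat) \<Rightarrow> move \<Rightarrow> move \<Rightarrow> nat" where
  "use_move c r = c(r := c r - 1)"

text \<open>
  The law of the score in the remaining \<open>m\<close> rounds when \<open>c i\<close> copies of move \<open>i\<close> remain. It is unfolded
  from the first of these rounds, while a history grows at its end; recursions for expectations
  need the former.
\<close>
primrec greedy_rest :: "nat \<Rightarrow> (move \<Rightarrow> nat) \<Rightarrow> int pmf" where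
  "greedy_rest 0 c = return_pmf 0"
| "greedy_rest (Suc m) c = bind_pmf (greedy_round {i. c i > 0})
     (\<lambda>x. map_pmf (\<lambda>y. round_score x + y) (greedy_rest m (use_move c (fst x))))"

text \<open>
  Markov property: given the history of the first \<open>k\<close> rounds, the remaining score depends only on the remaining moves.
\<close>
lemma score_play_greedy:
  "map_pmf score (play (greedy_R n) (greedy_N n) (k + m)) =
     bind_pmf (play (greedy_R n) (greedy_N n) k)
       (\<lambda>h. map_pmf (\<lambda>y. score h + y) (greedy_rest m (\<lambda>i. n - count_list (map fst h) i)))"
proof (induction m arbitrary: k)
  case 0
  show ?case by (simp add: map_pmf_def bind_return_pmf)
next
  case (Suc m)
  have count: "(\<lambda>i. n - count_list (map fst (h @ [x])) i) = use_move (\<lambda>i. n - count_list (map fst h) i) (fst x)"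
    for h :: history and x
    by (auto simp: fun_eq_iff use_move_def count_list_append)
  have score: "score (h @ [x]) = score h + round_score x" for h x by (simp add: score_def)
  have av: "available n h = {i. n - count_list (map fst h) i > 0}" for h by (auto simp: available_def)
  have "map_pmf score (play (greedy_R n) (greedy_N n) (k + Suc m)) =
    bind_pmf (play (greedy_R n) (greedy_N n) (Suc k))
       (\<lambda>h. map_pmf (\<lambda>y. score h + y) (greedy_rest m (\<lambda>i. n - count_list (map fst h) i)))"
    using Suc[of "Suc k"] by simp
  also have "\<dots> = bind_pmf (play (greedy_R n) (greedy_N n) k) (\<lambda>h. bind_pmf (greedy_round (available n h))
      (\<lambda>x. map_pmf (\<lambda>y. score (h @ [x]) + y) (greedy_rest m (\<lambda>i. n - count_list (map fst (h @ [x])) i))))"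
    by (simp add: bind_assoc_pmf bind_map_pmf greedy_round_available)
  also have "\<dots> = bind_pmf (play (greedy_R n) (greedy_N n) k)
       (\<lambda>h. map_pmf (\<lambda>y. score h + y) (greedy_rest (Suc m) (\<lambda>i. n - count_list (map fst h) i)))"
    unfolding count score av
    by (simp add: map_bind_pmf pmf.map_comp o_def add.assoc)
  finally show ?case .
qed

lemma greedy_score_eq_greedy_rest: "greedy_score n = greedy_rest (3 * n) (\<lambda>_. n)"
proof -
  have "map_pmf ((+) (0 :: int)) p = p" for p by (rule map_pmf_idI) simp
  thus ?thesis using score_play_greedy[of n 0 "3 * n"]
    by (simp add: greedy_score_def score_def bind_return_pmf)
qed

lemma finite_greedy_rest [simp]: "finite (set_pmf (greedy_rest m c))"
  by (induction m arbitrary: c) auto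

lemma abs_greedy_rest_le: "s \<in> set_pmf (greedy_rest m c) \<Longrightarrow> \<bar>s\<bar> \<le> int m"
proof (induction m arbitrary: c s)
  case (Suc m)
  then obtain x y where "s = round_score x + y" "y \<in> set_pmf (greedy_rest m (use_move c (fst x)))" by auto
  moreover have "\<bar>round_score x\<bar> \<le> 1" by (auto simp: round_score_def split: prod.splits)
  ultimately show ?case using Suc.IH[of y "use_move c (fst x)"] by linarith
qed simp

lemma expectation_greedy_rest_Suc:
  fixes \<phi> :: "int \<Rightarrow> real"
  shows "measure_pmf.expectation (greedy_rest (Suc m) c) \<phi> =
    measure_pmf.expectation (greedy_round {i. c i > 0})
      (\<lambda>x. measure_pmf.expectation (greedy_rest m (use_move c (fst x))) (\<lambda>y. \<phi> (round_score x + y)))"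
  by (simp add: expectation_bind_finite)

lemma move_neq [simp]:
  "j + 1 \<noteq> (j :: move)" "j + 2 \<noteq> j" "j + 1 \<noteq> j + 2" "j \<noteq> j + 1" "j \<noteq> j + 2" "j + 2 \<noteq> j + 1"
  by simp_all

lemma UNIV_move: "(UNIV :: move set) = {j, j + 1, j + 2}"
proof -
  have "card {j, j + 1, j + 2} = card (UNIV :: move set)" by (simp del: add_2_eq_Suc')
  thus ?thesis using card_subset_eq[of UNIV "{j, j + 1, j + 2}"] by (metis finite subset_UNIV)
qed

lemma sum_move: "(\<Sum>i\<in>UNIV. f i) = f j + f (j + 1) + f (j + 2)" for f :: "move \<Rightarrow> 'a::comm_monoid_add"
  unfolding UNIV_move[of j] by (simp add: add.assoc)

lemma move_add: "(j :: move) + 1 + 1 = j + 2" "j + 1 + 2 = j" "j + 2 + 1 = j" "j + 2 + 2 = j + 1"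
  by (simp_all add: add.assoc)

lemma round_score_simps [simp]:
  "round_score (i, i) = 0" "round_score (i, i + 1) = 1" "round_score (i, i + 2) = -1"
  by (simp_all add: round_score_def move_add)

lemma round_score_next: "round_score (i + 1, i + 2) = 1"
  using round_score_simps(2)[of "i + 1"] by (simp only: move_add)

lemma expectation_pair_pmf_finite:
  fixes f :: "'a \<times> 'b \<Rightarrow> real"
  assumes "finite (set_pmf p)" "finite (set_pmf q)"
  shows "measure_pmf.expectation (pair_pmf p q) f =
    measure_pmf.expectation p (\<lambda>x. measure_pmf.expectation q (\<lambda>y. f (x, y)))"
  unfolding pair_pmf_def using assms by (simp add: expectation_bind_finite)

lemma expectation_greedy_round_three:
  fixes f :: "move \<times> move \<Rightarrow> real"
  shows "measure_pmf.expectation (greedy_round UNIV) f = (\<Sum>r\<in>UNIV. \<Sum>s\<in>UNIV. f (r, s)) / 9"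
  by (simp add: greedy_round_def expectation_pair_pmf_finite integral_pmf_of_set sum_divide_distrib)

lemma expectation_greedy_round_two:
  fixes f :: "move \<times> move \<Rightarrow> real"
  shows "measure_pmf.expectation (greedy_round {i, i + 1}) f =
    2 / 9 * f (i, i + 1) + 1 / 9 * f (i, i + 2) + 4 / 9 * f (i + 1, i + 1) + 2 / 9 * f (i + 1, i + 2)"
proof -
  have card: "card {i, i + 1} = 2" by simp
  have neq: "{i, i + 1} \<noteq> UNIV" using UNIV_move[of i] move_neq by (metis UNIV_I insertE singletonD)
  have "(THE k. {i, i + 1} = {k, k + 1}) = i"
    using two_moves_unique[OF card] by (intro the1_equality) auto
  thus ?thesis unfolding greedy_round_def Let_def using card neq
    by (simp add: expectation_pair_pmf_finite field_simps)
qed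

lemma expectation_greedy_round_one:
  fixes f :: "move \<times> move \<Rightarrow> real"
  shows "measure_pmf.expectation (greedy_round {i}) f = f (i, i + 1)"
proof -
  have "{i} \<noteq> UNIV" using move_neq(1)[of i] by blast
  thus ?thesis unfolding greedy_round_def by (simp add: expectation_pair_pmf_finite)
qed

lemma greedy_rest_one:
  assumes "\<And>j. j \<noteq> i \<Longrightarrow> c j = 0" "c i = m"
  shows "measure_pmf.expectation (greedy_rest m c) \<phi> = (\<phi> (int m) :: real)"
  using assms
proof (induction m arbitrary: c \<phi>)
  case (Suc m)
  have "{k. c k > 0} = {i}" using Suc.prems by force
  moreover have "measure_pmf.expectation (greedy_rest m (use_move c i)) (\<lambda>y. \<phi> (1 + y)) = \<phi> (1 + int m)"
    using Suc.prems by (intro Suc.IH) (auto simp: use_move_def)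
  ultimately show ?case
    unfolding expectation_greedy_rest_Suc by (simp add: expectation_greedy_round_one)
qed simp


lemma expectation_greedy_rest_three:
  fixes \<phi> :: "int \<Rightarrow> real"
  assumes "\<And>i. c i > 0"
  shows "measure_pmf.expectation (greedy_rest (Suc m) c) \<phi> = (\<Sum>r\<in>UNIV. \<Sum>s\<in>UNIV.
      measure_pmf.expectation (greedy_rest m (use_move c r)) (\<lambda>y. \<phi> (round_score (r, s) + y))) / 9"
  using assms unfolding expectation_greedy_rest_Suc by (simp add: expectation_greedy_round_three)

lemma real_use_move: "c r > 0 \<Longrightarrow> real (use_move c r i) = real (c i) - (if r = i then 1 else 0)"
  unfolding use_move_def by (cases "r = i") (auto simp: of_nat_diff)

lemma sum_use_move:
  assumes "c r > 0" "(\<Sum>i\<in>UNIV. c i) = Suc m"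
  shows "(\<Sum>i\<in>UNIV. use_move c r i) = m"
proof -
  have "real (\<Sum>i\<in>UNIV. use_move c r i) = real (\<Sum>i\<in>UNIV. c i) - 1"
    by (simp add: real_use_move[of c r, OF assms(1)] sum_subtractf)
  thus ?thesis using assms(2) by (simp del: of_nat_sum)
qed

lemma sum_round_score:
  "(\<Sum>s\<in>UNIV. f (round_score (r, s))) = f 0 + f 1 + f (-1)" for f :: "int \<Rightarrow> 'a::comm_monoid_add"
  by (simp add: sum_move[of _ r])

section \<open>The score once a move is exhausted\<close>

text \<open>
  Let \<open>a\<close>, \<open>b\<close> copies of moves \<open>j + 1\<close>, \<open>j + 2\<close> remain and no copy of \<open>j\<close>. In the coordinates \<open>m = a + b\<close> and
  \<open>k = 2 * a - b\<close> the drift prediction \<open>max (b - a) a\<close> is \<open>m / 3 + kink k\<close>. While both moves remain, \<open>k\<close> is a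
  martingale, and so is the score so far plus \<open>m / 3\<close>.
\<close>
definition kink :: "real \<Rightarrow> real" where
  "kink k = max k (-2 * k) / 3"

lemma kink_bound: "(y - y0 + kink k - kink k0)\<^sup>2 \<le> 2 * (y - y0)\<^sup>2 + 8 / 9 * (k - k0)\<^sup>2"
proof -
  have "\<bar>kink k - kink k0\<bar> \<le> \<bar>2 / 3 * (k - k0)\<bar>" by (auto simp: kink_def max_def abs_if field_simps)
  hence "(kink k - kink k0)\<^sup>2 \<le> (2 / 3 * (k - k0))\<^sup>2" by (rule abs_le_square_iff[THEN iffD1])
  moreover have "(u + v)\<^sup>2 \<le> 2 * u\<^sup>2 + 2 * v\<^sup>2" for u v :: real
    using zero_le_power2[of "u - v"] by (simp add: power2_eq_square algebra_simps)
  from this[of "y - y0" "kink k - kink k0"] have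
    "(y - y0 + kink k - kink k0)\<^sup>2 \<le> 2 * (y - y0)\<^sup>2 + 2 * (kink k - kink k0)\<^sup>2" by (simp add: algebra_simps)
  moreover have "(2 / 3 * (k - k0))\<^sup>2 = 4 / 9 * (k - k0)\<^sup>2"
    by (subst power_mult_distrib) (simp add: power_divide)
  ultimately show ?thesis by linarith
qed

text \<open>
  The right-hand side is a martingale potential: per round, the two squares grow on average by \<open>4 / 9\<close> and
  \<open>2\<close>, and \<open>2 * (4 / 9) + 8 / 9 * 2 = 8 / 3\<close> is what the last term releases. When one of the two moves runs out
  the remaining score is \<open>m\<close>, and the claim becomes the Lipschitz bound for \<open>kink\<close>. The reference
  values \<open>y0\<close>, \<open>k0\<close> are kept fixed during the induction and set to the starting values afterwards.
\<close>
lemma greedy_rest_two_deviation: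
  fixes c :: "move \<Rightarrow> nat"
  assumes "c j = 0" "c (j + 1) + c (j + 2) = m"
  shows "measure_pmf.expectation (greedy_rest m c) (\<lambda>s. (w + of_int s - y0 - kink k0)\<^sup>2) \<le>
    2 * (w + m / 3 - y0)\<^sup>2 + 8 / 9 * (2 * real (c (j + 1)) - real (c (j + 2)) - k0)\<^sup>2 + 8 / 3 * m"
  using assms
proof (induction m arbitrary: c w)
  case 0
  thus ?case using kink_bound[of w y0 0 k0] by (simp add: kink_def)
next
  case (Suc m)
  define a where "a = c (j + 1)"
  define b where "b = c (j + 2)"
  have m: "real a + real b = real (Suc m)" using Suc.prems unfolding a_def b_def by linarith
  consider "a = 0" | "b = 0" | "a > 0" "b > 0" by linarith
  thus ?case
  proof cases
    case 1
    have "c i = 0" if "i \<noteq> j + 2" for i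
      using that Suc.prems(1) 1 UNIV_move[of j] unfolding a_def by (metis UNIV_I insertE singletonD)
    moreover have "c (j + 2) = Suc m" using Suc.prems 1 unfolding a_def by simp
    ultimately have "measure_pmf.expectation (greedy_rest (Suc m) c) (\<lambda>s. (w + of_int s - y0 - kink k0)\<^sup>2) =
        (w + Suc m - y0 - kink k0)\<^sup>2"
      by (subst greedy_rest_one[of "j + 2"]) auto
    also have "w + Suc m - y0 - kink k0 = w + Suc m / 3 - y0 + kink (2 * real a - real b) - kink k0"
      using 1 m by (simp add: kink_def max_def field_simps)
    also have "\<dots>\<^sup>2 \<le> 2 * (w + Suc m / 3 - y0)\<^sup>2 + 8 / 9 * (2 * real a - real b - k0)\<^sup>2"
      by (rule kink_bound)
    finally show ?thesis unfolding a_def b_def by (rule order_trans) simp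
  next
    case 2
    have "c i = 0" if "i \<noteq> j + 1" for i
      using that Suc.prems(1) 2 UNIV_move[of j] unfolding b_def by (metis UNIV_I insertE singletonD)
    moreover have "c (j + 1) = Suc m" using Suc.prems 2 unfolding b_def by simp
    ultimately have "measure_pmf.expectation (greedy_rest (Suc m) c) (\<lambda>s. (w + of_int s - y0 - kink k0)\<^sup>2) =
        (w + Suc m - y0 - kink k0)\<^sup>2"
      by (subst greedy_rest_one[of "j + 1"]) auto
    also have "w + Suc m - y0 - kink k0 = w + Suc m / 3 - y0 + kink (2 * real a - real b) - kink k0"
      using 2 m by (simp add: kink_def max_def field_simps)
    also have "\<dots>\<^sup>2 \<le> 2 * (w + Suc m / 3 - y0)\<^sup>2 + 8 / 9 * (2 * real a - real b - k0)\<^sup>2"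
      by (rule kink_bound)
    finally show ?thesis unfolding a_def b_def by (rule order_trans) simp
  next
    case 3
    have set: "{k. c k > 0} = {j + 1, j + 1 + 1}"
    proof -
      have "k = j \<or> k = j + 1 \<or> k = j + 2" for k using UNIV_move[of j] by blast
      thus ?thesis using Suc.prems(1) 3 unfolding a_def b_def move_add by force
    qed
    define Q where "Q y k = 2 * y\<^sup>2 + 8 / 9 * k\<^sup>2 + 8 / 3 * real m" for y k :: real
    define Y where "Y = w + Suc m / 3 - y0"
    define K where "K = 2 * real a - real b - k0"
    let ?E = "\<lambda>r w. measure_pmf.expectation (greedy_rest m (use_move c r))
      (\<lambda>s. (w + of_int s - y0 - kink k0)\<^sup>2)"
    have A: "?E (j + 1) v \<le> Q (v + m / 3 - y0) (K - 2)" for v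
    proof -
      have "use_move c (j + 1) j = 0" "use_move c (j + 1) (j + 1) + use_move c (j + 1) (j + 2) = m"
        "real (use_move c (j + 1) (j + 1)) = real a - 1" "real (use_move c (j + 1) (j + 2)) = real b"
        using 3 Suc.prems unfolding a_def b_def use_move_def by (simp_all add: of_nat_diff)
      moreover have K: "K - 2 = 2 * real a - 2 - real b - k0" by (simp add: K_def)
      ultimately show ?thesis using Suc.IH[of "use_move c (j + 1)" v] unfolding Q_def K by simp
    qed
    have B: "?E (j + 2) v \<le> Q (v + m / 3 - y0) (K + 1)" for v
    proof -
      have "use_move c (j + 2) j = 0" "use_move c (j + 2) (j + 1) + use_move c (j + 2) (j + 2) = m"
        "real (use_move c (j + 2) (j + 1)) = real a" "real (use_move c (j + 2) (j + 2)) = real b - 1"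
        using 3 Suc.prems unfolding a_def b_def use_move_def by (simp_all add: of_nat_diff)
      moreover have K: "K + 1 = 2 * real a - (real b - 1) - k0" by (simp add: K_def)
      ultimately show ?thesis using Suc.IH[of "use_move c (j + 2)" v] unfolding Q_def K by simp
    qed
    have "measure_pmf.expectation (greedy_rest (Suc m) c) (\<lambda>s. (w + of_int s - y0 - kink k0)\<^sup>2) =
      2 / 9 * ?E (j + 1) (w + 1) + 1 / 9 * ?E (j + 1) (w - 1) + 4 / 9 * ?E (j + 2) w + 2 / 9 * ?E (j + 2) (w + 1)"
      unfolding expectation_greedy_rest_Suc set expectation_greedy_round_two fst_conv
      unfolding move_add(1)
      using round_score_simps(3)[of "j + 1"] round_score_next[of "j + 1"] round_score_next[of j]
      by (simp add: move_add algebra_simps)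
    also have "\<dots> \<le> 2 / 9 * Q (w + 1 + m / 3 - y0) (K - 2) + 1 / 9 * Q (w - 1 + m / 3 - y0) (K - 2)
        + 4 / 9 * Q (w + m / 3 - y0) (K + 1) + 2 / 9 * Q (w + 1 + m / 3 - y0) (K + 1)"
      by (intro add_mono mult_left_mono A B) auto
    also have "\<dots> = 2 / 9 * Q (Y + 2 / 3) (K - 2) + 1 / 9 * Q (Y - 4 / 3) (K - 2)
        + 4 / 9 * Q (Y - 1 / 3) (K + 1) + 2 / 9 * Q (Y + 2 / 3) (K + 1)"
      unfolding Y_def by (simp add: algebra_simps add_divide_distrib)
    also have "\<dots> = 2 * Y\<^sup>2 + 8 / 9 * K\<^sup>2 + 8 / 3 * Suc m"
      unfolding Q_def by (simp add: power2_eq_square field_simps)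
    finally show ?thesis unfolding Y_def K_def a_def b_def .
  qed
qed

lemma greedy_rest_two_square:
  fixes c :: "move \<Rightarrow> nat"
  assumes "c j = 0" "c (j + 1) + c (j + 2) = m"
  shows "measure_pmf.expectation (greedy_rest m c)
      (\<lambda>s. (of_int s - max (real (c (j + 2)) - real (c (j + 1))) (real (c (j + 1))))\<^sup>2) \<le> 8 / 3 * m"
proof -
  let ?k = "2 * real (c (j + 1)) - real (c (j + 2))"
  have "real m / 3 + kink ?k = max (real (c (j + 2)) - real (c (j + 1))) (real (c (j + 1)))"
    using assms(2) by (auto simp: kink_def max_def field_simps)
  thus ?thesis using greedy_rest_two_deviation[OF assms, of 0 "real m / 3" ?k]
    by (simp add: diff_diff_add)
qed

section \<open>Exponential moments of the score\<close>

text \<open>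
  The growth factor, over one uniform round, of \<open>exp (l * score + \<bar>l\<bar> * (m - 3 * c i))\<close>: the score of
  the round and the move of the restricted player are independent.
\<close>
definition round_exp :: "real \<Rightarrow> real" where
  "round_exp l = (1 + exp l + exp (- l)) / 3 * ((exp (2 * \<bar>l\<bar>) + 2 * exp (- \<bar>l\<bar>)) / 3)"

lemma exp_plus_exp_minus_ge: "exp x + exp (- x) \<ge> (2 :: real)"
  using exp_ge_add_one_self[of x] exp_ge_add_one_self[of "- x"] by linarith

lemma round_exp_ge_1: "round_exp l \<ge> 1"
proof -
  have "exp (2 * \<bar>l\<bar>) + 2 * exp (- \<bar>l\<bar>) \<ge> 3"
    using exp_ge_add_one_self[of "2 * \<bar>l\<bar>"] exp_ge_add_one_self[of "- \<bar>l\<bar>"] by linarith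
  hence "1 * 1 \<le> round_exp l" unfolding round_exp_def
    using exp_plus_exp_minus_ge[of l] by (intro mult_mono) auto
  thus ?thesis by simp
qed

text \<open>
  In an average of such bounds with weights of mean zero the linear terms cancel, which leaves a
  Gaussian bound for the exponential moment.
\<close>
lemma exp_le_plus_exp_square: "exp x \<le> x + exp (x\<^sup>2)" for x :: real
proof -
  have sq: "1 + x\<^sup>2 \<le> exp (x\<^sup>2)" by simp
  consider "x > 1" | "x < - 1" | "0 \<le> x" "x \<le> 1" | "- 1 \<le> x" "x \<le> 0" by linarith
  thus ?thesis
  proof cases
    case 1
    hence "exp x \<le> exp (x\<^sup>2)" by (simp add: power2_eq_square)
    thus ?thesis using 1 by linarith
  next
    case 2
    hence "x * (x + 1) \<ge> 0" by (intro mult_nonpos_nonpos) auto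
    hence "x + x\<^sup>2 \<ge> 0" by (simp add: power2_eq_square algebra_simps)
    moreover have "exp x \<le> 1" using 2 by simp
    ultimately show ?thesis using sq by linarith
  next
    case 3
    thus ?thesis using exp_bound[of x] sq by linarith
  next
    case 4
    have "exp x * (1 - x) \<le> exp x * exp (- x)"
      using exp_ge_add_one_self[of "- x"] by (intro mult_left_mono) auto
    hence "exp x * (1 - x) \<le> 1" by (simp add: exp_minus)
    moreover have "1 \<le> (1 + x + x\<^sup>2) * (1 - x)"
    proof -
      have "(1 + x + x\<^sup>2) * (1 - x) = 1 - x * x\<^sup>2" by (simp add: power2_eq_square algebra_simps)
      moreover have "x * x\<^sup>2 \<le> 0" using 4 by (intro mult_nonpos_nonneg) auto
      ultimately show ?thesis by simp
    qed
    ultimately have "exp x * (1 - x) \<le> (1 + x + x\<^sup>2) * (1 - x)" by linarith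
    hence "exp x \<le> 1 + x + x\<^sup>2" using 4 by (simp add: mult_le_cancel_right)
    thus ?thesis using sq by linarith
  qed
qed

lemma round_exp_le: "round_exp l \<le> exp (5 * l\<^sup>2)"
proof -
  have "(1 + exp l + exp (- l)) / 3 \<le> exp (l\<^sup>2)"
  proof -
    have "1 \<le> exp (l\<^sup>2)" by simp
    thus ?thesis using exp_le_plus_exp_square[of l] exp_le_plus_exp_square[of "- l"]
      unfolding power2_minus by argo
  qed
  moreover have "(exp (2 * \<bar>l\<bar>) + 2 * exp (- \<bar>l\<bar>)) / 3 \<le> exp (4 * l\<^sup>2)"
  proof -
    have "exp (l\<^sup>2) \<le> exp (4 * l\<^sup>2)" by simp
    moreover have "exp (2 * \<bar>l\<bar>) \<le> 2 * \<bar>l\<bar> + exp (4 * l\<^sup>2)"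
      using exp_le_plus_exp_square[of "2 * \<bar>l\<bar>"] by (simp add: power_mult_distrib)
    moreover have "exp (- \<bar>l\<bar>) \<le> - \<bar>l\<bar> + exp (l\<^sup>2)"
      using exp_le_plus_exp_square[of "- \<bar>l\<bar>"] by simp
    ultimately show ?thesis by argo
  qed
  ultimately have "round_exp l \<le> exp (l\<^sup>2) * exp (4 * l\<^sup>2)"
    unfolding round_exp_def by (intro mult_mono) (auto simp: add_nonneg_nonneg)
  thus ?thesis by (simp flip: exp_add)
qed

text \<open>
  Once \<open>c j = 0\<close>, the remaining score is at most \<open>m = m - 3 * c j\<close> in absolute value, so the sum dominates.
  While all moves remain, each summand is multiplied by \<open>round_exp l\<close> on average over a round. The
  quantities \<open>m - 3 * c i\<close> vanish at the start of the game, which leaves a bound by the growth factors alone.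
\<close>
lemma exponential_moment_greedy_rest:
  assumes "(\<Sum>i\<in>UNIV. c i) = m"
  shows "measure_pmf.expectation (greedy_rest m c) (\<lambda>s. exp (l * of_int s)) \<le>
    round_exp l ^ m * (\<Sum>i\<in>UNIV. exp (\<bar>l\<bar> * (real m - 3 * real (c i))))"
  using assms
proof (induction m arbitrary: c)
  case 0
  thus ?case by simp
next
  case (Suc m)
  show ?case
  proof (cases "\<exists>j. c j = 0")
    case True
    then obtain j where j: "c j = 0" ..
    have "measure_pmf.expectation (greedy_rest (Suc m) c) (\<lambda>s. exp (l * of_int s)) \<le>
        measure_pmf.expectation (greedy_rest (Suc m) c) (\<lambda>s. exp (\<bar>l\<bar> * Suc m))"
    proof (intro integral_mono_AE AE_pmfI integrable_measure_pmf_finite finite_greedy_rest)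
      fix s assume "s \<in> set_pmf (greedy_rest (Suc m) c)"
      hence "\<bar>real_of_int s\<bar> \<le> Suc m" using abs_greedy_rest_le[of s "Suc m" c] by linarith
      hence "\<bar>l\<bar> * \<bar>real_of_int s\<bar> \<le> \<bar>l\<bar> * Suc m" by (intro mult_left_mono) auto
      thus "exp (l * of_int s) \<le> exp (\<bar>l\<bar> * Suc m)" using abs_le_D1[of "l * of_int s"] by (simp add: abs_mult)
    qed
    also have "\<dots> = exp (\<bar>l\<bar> * (real (Suc m) - 3 * real (c j)))" using j by simp
    also have "\<dots> \<le> (\<Sum>i\<in>UNIV. exp (\<bar>l\<bar> * (real (Suc m) - 3 * real (c i))))"
      by (rule member_le_sum) auto
    also have "\<dots> \<le> round_exp l ^ Suc m * (\<Sum>i\<in>UNIV. exp (\<bar>l\<bar> * (real (Suc m) - 3 * real (c i))))"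
      using mult_right_mono[OF one_le_power[OF round_exp_ge_1, of l "Suc m"]] by (simp add: sum_nonneg)
    finally show ?thesis .
  next
    case False
    hence pos: "c i > 0" for i by auto
    let ?e = "\<lambda>i. exp (\<bar>l\<bar> * (real (Suc m) - 3 * real (c i)))"
    let ?z = "\<lambda>r i. exp (\<bar>l\<bar> * (real m - 3 * real (use_move c r i)))"
    let ?F = "\<lambda>r. measure_pmf.expectation (greedy_rest m (use_move c r)) (\<lambda>s. exp (l * of_int s))"
    have "measure_pmf.expectation (greedy_rest (Suc m) c) (\<lambda>s. exp (l * of_int s)) =
       (\<Sum>r\<in>UNIV. \<Sum>s\<in>UNIV. exp (l * round_score (r, s)) * ?F r) / 9"
      unfolding expectation_greedy_rest_three[OF pos] by (simp add: distrib_left exp_add)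
    also have "\<dots> = (\<Sum>r\<in>UNIV. (1 + exp l + exp (- l)) * ?F r) / 9"
      unfolding sum_distrib_right[symmetric] sum_round_score[of "\<lambda>s. exp (l * of_int s)"] by simp
    also have "\<dots> \<le> (\<Sum>r\<in>UNIV. (1 + exp l + exp (- l)) * (round_exp l ^ m * (\<Sum>i\<in>UNIV. ?z r i))) / 9"
      using Suc.prems pos sum_use_move
      by (intro divide_right_mono sum_mono mult_left_mono Suc.IH) (auto simp: add_nonneg_nonneg)
    also have "\<dots> = (1 + exp l + exp (- l)) / 9 * round_exp l ^ m * (\<Sum>i\<in>UNIV. \<Sum>r\<in>UNIV. ?z r i)"
      by (subst sum.swap) (simp add: sum_distrib_left mult.assoc sum_divide_distrib)
    also have "(\<Sum>i\<in>UNIV. \<Sum>r\<in>UNIV. ?z r i) =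
        (exp (2 * \<bar>l\<bar>) + 2 * exp (- \<bar>l\<bar>)) * (\<Sum>i\<in>UNIV. ?e i)"
    proof -
      have "(\<Sum>r\<in>UNIV. ?z r i) = (exp (2 * \<bar>l\<bar>) + 2 * exp (- \<bar>l\<bar>)) * ?e i" for i
      proof -
        have "?z r i = (if r = i then exp (2 * \<bar>l\<bar>) else exp (- \<bar>l\<bar>)) * ?e i" for r
          unfolding real_use_move[of c r, OF pos] by (simp add: algebra_simps flip: exp_add)
        thus ?thesis by (simp add: sum_move[of _ i] algebra_simps)
      qed
      thus ?thesis by (simp add: sum_distrib_left)
    qed
    also have "(1 + exp l + exp (- l)) / 9 * round_exp l ^ m *
        ((exp (2 * \<bar>l\<bar>) + 2 * exp (- \<bar>l\<bar>)) * (\<Sum>i\<in>UNIV. ?e i)) = round_exp l ^ Suc m * (\<Sum>i\<in>UNIV. ?e i)"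
      by (simp add: round_exp_def)
    finally show ?thesis .
  qed
qed

text \<open>
  Over \<open>3 * n\<close> rounds the growth factors amount to at most \<open>exp (5 * (l / sqrt n)\<^sup>2 * (3 * n))\<close>, which is
  independent of \<open>n\<close>.
\<close>
lemma exponential_moment_greedy_score:
  assumes "\<bar>l\<bar> \<le> 1"
  shows "measure_pmf.expectation (greedy_score n) (\<lambda>s. exp (l * (of_int s / sqrt n))) \<le> 3 * exp 15"
proof (cases "n = 0")
  case True
  have "1 \<le> exp (15 :: real)" by simp
  hence "1 \<le> 3 * exp (15 :: real)" by linarith
  thus ?thesis using True by simp
next
  case False
  let ?l = "l / sqrt n"
  have "measure_pmf.expectation (greedy_score n) (\<lambda>s. exp (?l * of_int s)) \<le> round_exp ?l ^ (3 * n) * 3"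
    using exponential_moment_greedy_rest[of "\<lambda>_. n" "3 * n" ?l]
    by (simp add: greedy_score_eq_greedy_rest)
  also have "round_exp ?l ^ (3 * n) \<le> exp (5 * ?l\<^sup>2) ^ (3 * n)"
    using round_exp_ge_1[of ?l] by (intro power_mono round_exp_le) auto
  also have "\<dots> = exp (15 * l\<^sup>2)" using False
    by (simp add: power_divide flip: exp_of_nat_mult)
  also have "\<dots> \<le> exp 15" using assms by (simp add: abs_square_le_1)
  finally show ?thesis by (simp add: mult.commute)
qed

lemma greedy_score_moment_bound:
  "measure_pmf.expectation (greedy_score n) (\<lambda>s. (of_int s / sqrt n) ^ (2 * k)) \<le> fact (2 * k) * (6 * exp 15)"
proof -
  have fin: "finite (set_pmf (greedy_score n))" by (simp add: greedy_score_eq_greedy_rest)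
  have pow: "x ^ (2 * k) \<le> fact (2 * k) * (exp x + exp (- x))" for x :: real
  proof -
    have "\<bar>x\<bar> ^ (2 * k) / fact (2 * k) \<le> exp \<bar>x\<bar>"
    proof -
      have "(\<Sum>i\<in>{2 * k}. \<bar>x\<bar> ^ i /\<^sub>R fact i) \<le> exp \<bar>x\<bar>"
        unfolding exp_def by (rule sum_le_suminf[OF summable_exp_generic]) auto
      thus ?thesis by (simp add: divide_inverse mult.commute)
    qed
    also have "exp \<bar>x\<bar> \<le> exp x + exp (- x)" by (simp add: abs_if)
    finally show ?thesis using pos_divide_le_eq[of "fact (2 * k) :: real"]
      by (simp add: power_even_abs mult.commute)
  qed
  have "measure_pmf.expectation (greedy_score n) (\<lambda>s. (of_int s / sqrt n) ^ (2 * k)) \<le>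
    measure_pmf.expectation (greedy_score n)
      (\<lambda>s. fact (2 * k) * (exp (1 * (of_int s / sqrt n)) + exp (- 1 * (of_int s / sqrt n))))"
    using pow by (intro integral_mono integrable_measure_pmf_finite fin) auto
  also have "\<dots> = fact (2 * k) *
    (measure_pmf.expectation (greedy_score n) (\<lambda>s. exp (1 * (of_int s / sqrt n))) +
     measure_pmf.expectation (greedy_score n) (\<lambda>s. exp (- 1 * (of_int s / sqrt n))))"
    by (subst integral_mult_right_zero, subst Bochner_Integration.integral_add)
      (auto intro: integrable_measure_pmf_finite fin)
  also have "\<dots> \<le> fact (2 * k) * (3 * exp 15 + 3 * exp 15)"
    by (intro mult_left_mono add_mono exponential_moment_greedy_score) auto
  finally show ?thesis by simp
qed

section \<open>Comparison with a uniform random walk\<close>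

text \<open>
  The first component is the score in a game of uniform play, the second is, for each move, the excess of
  its number of uses by the restricted player over one third of the rounds.
\<close>
definition limit_score :: "real \<times> (real^3) \<Rightarrow> real" where
  "limit_score = (\<lambda>(w, x). w + Max {x $ 1 + 2 * x $ 2, x $ 2 + 2 * x $ 3, x $ 3 + 2 * x $ 1})"

lemma limit_score_eq:
  "limit_score z = fst z + max (snd z $ 1 + 2 * snd z $ 2) (max (snd z $ 2 + 2 * snd z $ 3) (snd z $ 3 + 2 * snd z $ 1))"
  by (simp add: limit_score_def split_beta)

lemma abs_max3_diff_le:
  fixes a :: real
  assumes "\<bar>a - a'\<bar> \<le> d" "\<bar>b - b'\<bar> \<le> d" "\<bar>c - c'\<bar> \<le> d"
  shows "\<bar>max a (max b c) - max a' (max b' c')\<bar> \<le> d"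
  using assms by (auto simp: max_def abs_le_iff)

lemma limit_score_lipschitz: "\<bar>limit_score z - limit_score z'\<bar> \<le> 4 * norm (z - z')"
proof -
  have w: "\<bar>fst z - fst z'\<bar> \<le> norm (z - z')" using norm_fst_le[of "fst z - fst z'" "snd z - snd z'"]
    by (simp flip: minus_prod_def)
  have comp: "\<bar>snd z $ i - snd z' $ i\<bar> \<le> norm (z - z')" for i
  proof -
    have "\<bar>snd z $ i - snd z' $ i\<bar> \<le> norm (snd z - snd z')"
      using component_le_norm_cart[of "snd z - snd z'" i] by simp
    also have "\<dots> \<le> norm (z - z')"
      using norm_snd_le[of "snd z - snd z'" "fst z - fst z'"] by (simp flip: minus_prod_def)
    finally show ?thesis .
  qed
  have "\<bar>(snd z $ i + 2 * snd z $ j) - (snd z' $ i + 2 * snd z' $ j)\<bar> \<le> 3 * norm (z - z')" for i j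
    using comp[of i] comp[of j] by linarith
  note max = abs_max3_diff_le[OF this[of 1 2] this[of 2 3] this[of 3 1]]
  have "\<bar>(a + p) - (b + q)\<bar> \<le> 4 * d" if "\<bar>a - b\<bar> \<le> d" "\<bar>p - q\<bar> \<le> 3 * d" for a b p q d :: real
    using that by linarith
  from this[OF w max] show ?thesis unfolding limit_score_eq .
qed

text \<open>
  Invariance under cyclic relabelling, which allows the exhausted move to be called \<open>j\<close>.
\<close>
lemma limit_score_cyclic:
  "limit_score z = fst z + max (snd z $ j + 2 * snd z $ (j + 1))
    (max (snd z $ (j + 1) + 2 * snd z $ (j + 2)) (snd z $ (j + 2) + 2 * snd z $ j))"
proof -
  have mod3: "(4 :: move) = 1" "(5 :: move) = 2" by simp_all
  have "j = 1 \<or> j = 2 \<or> j = 3" by (rule exhaust_3)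
  thus ?thesis
    by (elim disjE) (simp_all add: limit_score_eq mod3 max.assoc max.commute max.left_commute)
qed

lemma continuous_limit_score: "continuous_on UNIV limit_score"
  unfolding limit_score_eq[abs_def] by (intro continuous_intros)

lemma limit_score_scale: "a \<ge> 0 \<Longrightarrow> limit_score (a *\<^sub>R z) = a * limit_score z"
  unfolding limit_score_eq by (simp add: distrib_left max_mult_distrib_left mult.left_commute)

text \<open>
  Centring the move counts by \<open>1 / 3\<close> makes the walk a martingale and keeps the sum of the coordinates at
  \<open>0\<close>, so that \<open>x j + 2 * x (j + 1)\<close> is the difference \<open>x (j + 1) - x (j + 2)\<close> of two move counts.
\<close>
definition round_step :: "move \<times> move \<Rightarrow> real \<times> (real^3)" where
  "round_step x = (of_int (round_score x), axis (fst x) 1 - (\<chi> i. 1 / 3))"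

definition uniform_step :: "(real \<times> (real^3)) pmf" where
  "uniform_step = map_pmf round_step (pmf_of_set UNIV)"

lemma finite_uniform_step [simp]: "finite (set_pmf uniform_step)"
  by (simp add: uniform_step_def)

lemma expectation_uniform_step:
  fixes f :: "real \<times> (real^3) \<Rightarrow> real"
  shows "measure_pmf.expectation uniform_step f = (\<Sum>r\<in>UNIV. \<Sum>s\<in>UNIV. f (round_step (r, s))) / 9"
proof -
  have "measure_pmf.expectation uniform_step f = (\<Sum>x\<in>UNIV. f (round_step x)) / 9"
    by (simp add: uniform_step_def integral_pmf_of_set)
  also have "(\<Sum>x\<in>UNIV. f (round_step x)) = (\<Sum>r\<in>UNIV. \<Sum>s\<in>UNIV. f (round_step (r, s)))"
    by (simp add: sum.cartesian_product case_prod_beta' flip: UNIV_Times_UNIV)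
  finally show ?thesis .
qed

lemma expectation_uniform_step_eq:
  fixes f :: "real \<times> (real^3) \<Rightarrow> real"
  shows "measure_pmf.expectation uniform_step f = (\<Sum>r\<in>UNIV.
    f (0, axis r 1 - (\<chi> i. 1 / 3)) + f (1, axis r 1 - (\<chi> i. 1 / 3)) + f (-1, axis r 1 - (\<chi> i. 1 / 3))) / 9"
proof -
  have "(\<Sum>s\<in>UNIV. f (round_step (r, s))) = f (0, axis r 1 - (\<chi> i. 1 / 3))
      + f (1, axis r 1 - (\<chi> i. 1 / 3)) + f (-1, axis r 1 - (\<chi> i. 1 / 3))" for r
    using sum_round_score[of "\<lambda>k. f (of_int k, axis r 1 - (\<chi> i. 1 / 3))" r]
    by (simp add: round_step_def)
  thus ?thesis unfolding expectation_uniform_step by simp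
qed

lemma inner_centred_axis: "v \<bullet> (axis r 1 - (\<chi> i. 1 / 3)) = v $ r - (\<Sum>i\<in>UNIV. v $ i) / 3"
  for v :: "real^3"
  by (simp add: inner_diff_right inner_axis) (simp add: inner_vec_def flip: sum_divide_distrib)

lemma expectation_inner_uniform_step: "measure_pmf.expectation uniform_step (\<lambda>x. t \<bullet> x) = 0"
proof (cases t)
  case (Pair a v)
  show ?thesis unfolding Pair expectation_uniform_step_eq
    by (simp add: inner_centred_axis sum_move[of _ 1] field_simps)
qed

lemma mean_uniform_step: "measure_pmf.expectation uniform_step (\<lambda>x. x) = 0"
proof -
  have "t \<bullet> measure_pmf.expectation uniform_step (\<lambda>x. x) = 0" for t
    using integral_inner_right[of t uniform_step "\<lambda>x. x"] expectation_inner_uniform_step[of t]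
    by (simp add: integrable_measure_pmf_finite)
  thus ?thesis by (metis inner_eq_zero_iff)
qed

lemma variance_uniform_step:
  "measure_pmf.expectation uniform_step (\<lambda>x. ((a, v) \<bullet> x)\<^sup>2) =
    2 / 3 * a\<^sup>2 + ((\<Sum>i\<in>UNIV. (v $ i)\<^sup>2) - (\<Sum>i\<in>UNIV. v $ i)\<^sup>2 / 3) / 3"
  unfolding expectation_uniform_step_eq
  by (simp add: inner_centred_axis sum_move[of _ 1] power2_eq_square field_simps)

lemma norm_centred_axis: "(norm (axis r 1 - (\<chi> i. 1 / 3) :: real^3))\<^sup>2 = 2 / 3"
proof -
  have "(norm (axis r 1 - (\<chi> i. 1 / 3) :: real^3))\<^sup>2 =
      (axis r 1 - (\<chi> i. 1 / 3) :: real^3) $ r - (\<Sum>i\<in>UNIV. (axis r 1 - (\<chi> i. 1 / 3) :: real^3) $ i) / 3"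
    unfolding power2_norm_eq_inner inner_centred_axis ..
  also have "\<dots> = 2 / 3" by (simp add: sum_move[of _ r] axis_def)
  finally show ?thesis .
qed

lemma square_norm_uniform_step: "measure_pmf.expectation uniform_step (\<lambda>x. (norm x)\<^sup>2) = 4 / 3"
  unfolding expectation_uniform_step_eq
  by (simp add: norm_Pair norm_centred_axis)

text \<open>
  The point of the walk when the score is \<open>w\<close> and \<open>c i\<close> copies of move \<open>i\<close> remain in \<open>m\<close> rounds: if every move
  had \<open>n\<close> copies at the start, move \<open>i\<close> has been made \<open>n - c i\<close> times in \<open>3 * n - m\<close> rounds.
\<close>
definition position :: "real \<Rightarrow> nat \<Rightarrow> (move \<Rightarrow> nat) \<Rightarrow> real \<times> (real^3)" where
  "position w m c = (w, \<chi> i. real m / 3 - real (c i))"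

lemma position_step:
  assumes "c r > 0"
  shows "position w (Suc m) c + round_step (r, s) = position (w + of_int (round_score (r, s))) m (use_move c r)"
  using assms unfolding position_def round_step_def
  by (auto simp: vec_eq_iff axis_def real_use_move field_simps)

text \<open>
  When move \<open>j\<close> is exhausted, \<open>limit_score\<close> is the score so far plus the drift prediction for the rest: of the three
  terms of the maximum, the one equal to \<open>- c (j + 2)\<close> never exceeds \<open>c (j + 1)\<close>.
\<close>
lemma limit_score_boundary:
  assumes "c j = 0" "c (j + 1) + c (j + 2) = m"
  shows "limit_score (position w m c) = w + max (real (c (j + 2)) - real (c (j + 1))) (real (c (j + 1)))"
proof -
  have m: "real m = real (c (j + 1)) + real (c (j + 2))" using assms(2) by linarith
  have "limit_score (position w m c) = w + max (real (c (j + 2)) - real (c (j + 1)))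
      (max (- real (c (j + 2))) (real (c (j + 1))))"
  proof -
    let ?x = "snd (position w m c)"
    have "?x $ j + 2 * ?x $ (j + 1) = real (c (j + 2)) - real (c (j + 1))"
      "?x $ (j + 1) + 2 * ?x $ (j + 2) = - real (c (j + 2))"
      "?x $ (j + 2) + 2 * ?x $ j = real (c (j + 1))"
      using assms(1) by (simp_all add: position_def m field_simps)
    moreover have "fst (position w m c) = w" by (simp add: position_def)
    ultimately show ?thesis by (simp only: limit_score_cyclic[of _ j])
  qed
  thus ?thesis by (simp add: max_def)
qed

lemma expectation_abs_le:
  fixes f :: "'a \<Rightarrow> real"
  assumes "finite (set_pmf p)" "e > 0"
  shows "measure_pmf.expectation p (\<lambda>x. \<bar>f x\<bar>) \<le> (e + measure_pmf.expectation p (\<lambda>x. (f x)\<^sup>2) / e) / 2"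
proof -
  have "\<bar>f x\<bar> \<le> (e + (f x)\<^sup>2 / e) / 2" for x
    using zero_le_power2[of "\<bar>f x\<bar> - e"] assms(2) by (simp add: power2_eq_square field_simps)
  hence "measure_pmf.expectation p (\<lambda>x. \<bar>f x\<bar>) \<le> measure_pmf.expectation p (\<lambda>x. (e + (f x)\<^sup>2 / e) / 2)"
    using assms(1) by (intro integral_mono integrable_measure_pmf_finite)
  also have "\<dots> = (e + measure_pmf.expectation p (\<lambda>x. (f x)\<^sup>2) / e) / 2"
    using assms(1) by (simp add: integrable_measure_pmf_finite)
  finally show ?thesis .
qed

lemma expectation_lipschitz:
  fixes f :: "real \<Rightarrow> real"
  assumes "finite (set_pmf p)" "\<And>x y. \<bar>f x - f y\<bar> \<le> L * \<bar>x - y\<bar>"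
  shows "\<bar>measure_pmf.expectation p (\<lambda>x. f (h x)) - f a\<bar> \<le> L * measure_pmf.expectation p (\<lambda>x. \<bar>h x - a\<bar>)"
proof -
  have "\<bar>measure_pmf.expectation p (\<lambda>x. f (h x)) - f a\<bar> = \<bar>measure_pmf.expectation p (\<lambda>x. f (h x) - f a)\<bar>"
    using assms(1) by (simp add: integrable_measure_pmf_finite)
  also have "\<dots> \<le> measure_pmf.expectation p (\<lambda>x. \<bar>f (h x) - f a\<bar>)" by (rule integral_abs_bound)
  also have "\<dots> \<le> measure_pmf.expectation p (\<lambda>x. L * \<bar>h x - a\<bar>)"
    using assms by (intro integral_mono integrable_measure_pmf_finite)
  finally show ?thesis by simp
qed

text \<open>
  Each \<open>m - 3 * c i\<close> is a martingale of variance \<open>2\<close> per round under uniform play, so the sum is harmonic; and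
  it bounds \<open>m\<^sup>2\<close> at states with an exhausted move.
\<close>
definition spread :: "nat \<Rightarrow> (move \<Rightarrow> nat) \<Rightarrow> real" where
  "spread m c = (\<Sum>i\<in>UNIV. (real m - 3 * real (c i))\<^sup>2 + 2 * real m)"

lemma spread_harmonic:
  assumes "\<And>i. c i > 0"
  shows "(\<Sum>r\<in>UNIV. spread m (use_move c r)) = 3 * spread (Suc m) c"
proof -
  have "(\<Sum>r\<in>UNIV. (real m - 3 * real (use_move c r i))\<^sup>2 + 2 * real m) =
      3 * ((real (Suc m) - 3 * real (c i))\<^sup>2 + 2 * real (Suc m))" for i
    unfolding real_use_move[of c, OF assms]
    by (simp add: sum_move[of _ i] power2_eq_square algebra_simps)
  thus ?thesis unfolding spread_def by (subst sum.swap) (simp add: sum_distrib_left)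
qed

lemma spread_boundary:
  assumes "c j = 0" "N > 0"
  shows "real m \<le> (spread m c / N + N) / 2"
proof -
  have "(real m)\<^sup>2 \<le> (real m - 3 * real (c j))\<^sup>2 + 2 * real m" using assms by simp
  also have "\<dots> \<le> spread m c" unfolding spread_def by (rule member_le_sum) auto
  finally have "(real m)\<^sup>2 \<le> spread m c" .
  moreover have "real m \<le> ((real m)\<^sup>2 / N + N) / 2"
    using zero_le_power2[of "real m - N"] assms(2) by (simp add: power2_eq_square field_simps)
  ultimately show ?thesis using assms(2) by (smt (verit) divide_right_mono)
qed

text \<open>
  At a state with an exhausted move, both sides are concentrated around the same number, with variances
  of order \<open>m\<close>. The bound \<open>\<bar>x\<bar> \<le> (e + x\<^sup>2 / e) / 2\<close> turns these into first moments; keeping \<open>e\<close>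
  free makes the estimate linear in \<open>m\<close>, so that it can be averaged over the random value of \<open>m\<close>.
\<close>
lemma greedy_rest_close_boundary:
  fixes f :: "real \<Rightarrow> real"
  assumes f: "\<And>x y. \<bar>f x - f y\<bar> \<le> L * \<bar>x - y\<bar>" and e: "e > 0"
    and c: "c j = 0" "(\<Sum>i\<in>UNIV. c i) = m"
  shows "\<bar>measure_pmf.expectation (greedy_rest m c) (\<lambda>s. f (w + of_int s)) -
      measure_pmf.expectation (iid_sum uniform_step m) (\<lambda>x. f (limit_score (position w m c + x)))\<bar>
    \<le> L * (3 * e + 4 / e * m)"
proof -
  define a where "a = limit_score (position w m c)"
  have L: "L \<ge> 0" using f[of 1 0] by simp
  have c': "c (j + 1) + c (j + 2) = m" using c by (simp add: sum_move[of _ j])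
  note fin = finite_iid_sum[OF finite_uniform_step, of m]
  have "measure_pmf.expectation (greedy_rest m c) (\<lambda>s. \<bar>w + of_int s - a\<bar>) \<le>
     (e + measure_pmf.expectation (greedy_rest m c) (\<lambda>s. (w + of_int s - a)\<^sup>2) / e) / 2"
    using e by (intro expectation_abs_le) auto
  also have "measure_pmf.expectation (greedy_rest m c) (\<lambda>s. (w + of_int s - a)\<^sup>2) \<le> 8 / 3 * m"
    using greedy_rest_two_square[OF c(1) c'] unfolding a_def limit_score_boundary[OF c(1) c']
    by (simp add: algebra_simps)
  finally have 1: "measure_pmf.expectation (greedy_rest m c) (\<lambda>s. \<bar>w + of_int s - a\<bar>) \<le> (e + 8 / 3 * m / e) / 2"
    using e by (simp add: divide_right_mono)
  have "measure_pmf.expectation (iid_sum uniform_step m) (\<lambda>x. \<bar>limit_score (position w m c + x) - a\<bar>) \<le>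
      measure_pmf.expectation (iid_sum uniform_step m) (\<lambda>x. 4 * \<bar>norm x\<bar>)"
  proof (intro integral_mono integrable_measure_pmf_finite fin)
    fix x show "\<bar>limit_score (position w m c + x) - a\<bar> \<le> 4 * \<bar>norm x\<bar>"
      using limit_score_lipschitz[of "position w m c + x" "position w m c"] by (simp add: a_def)
  qed
  also have "\<dots> = 4 * measure_pmf.expectation (iid_sum uniform_step m) (\<lambda>x. \<bar>norm x\<bar>)" by simp
  also have "\<dots> \<le> 4 * ((e + measure_pmf.expectation (iid_sum uniform_step m) (\<lambda>x. (norm x)\<^sup>2) / e) / 2)"
    using e fin by (intro mult_left_mono expectation_abs_le) auto
  also have "measure_pmf.expectation (iid_sum uniform_step m) (\<lambda>x. (norm x)\<^sup>2) = real m * (4 / 3)"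
    by (simp add: second_moment_iid_sum mean_uniform_step square_norm_uniform_step)
  finally have 2: "measure_pmf.expectation (iid_sum uniform_step m) (\<lambda>x. \<bar>limit_score (position w m c + x) - a\<bar>)
      \<le> 4 * ((e + real m * (4 / 3) / e) / 2)" .
  have "\<bar>measure_pmf.expectation (greedy_rest m c) (\<lambda>s. f (w + of_int s)) -
      measure_pmf.expectation (iid_sum uniform_step m) (\<lambda>x. f (limit_score (position w m c + x)))\<bar>
    \<le> L * ((e + 8 / 3 * m / e) / 2) + L * (4 * ((e + real m * (4 / 3) / e) / 2))"
    using expectation_lipschitz[OF finite_greedy_rest f, of m c "\<lambda>s. w + of_int s" a]
      expectation_lipschitz[OF fin f, of "\<lambda>x. limit_score (position w m c + x)" a]
      mult_left_mono[OF 1 L] mult_left_mono[OF 2 L] by linarith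
  also have "\<dots> \<le> L * (3 * e + 4 / e * m)"
    unfolding distrib_left[symmetric] using L e by (intro mult_left_mono) (auto simp: field_simps)
  finally show ?thesis .
qed

text \<open>
  Maximum principle: the two values satisfy the same recursion while all moves remain, the bound is
  harmonic for it, and at states with an exhausted move the bound holds. The parameter \<open>N\<close> enters through
  \<open>m \<le> (m\<^sup>2 / N + N) / 2\<close>.
\<close>
lemma greedy_rest_close:
  fixes f :: "real \<Rightarrow> real"
  assumes f: "\<And>x y. \<bar>f x - f y\<bar> \<le> L * \<bar>x - y\<bar>" and e: "e > 0" and N: "N > 0"
    and c: "(\<Sum>i\<in>UNIV. c i) = m"
  shows "\<bar>measure_pmf.expectation (greedy_rest m c) (\<lambda>s. f (w + of_int s)) -
      measure_pmf.expectation (iid_sum uniform_step m) (\<lambda>x. f (limit_score (position w m c + x)))\<bar>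
    \<le> L * (3 * e + 2 / e * (spread m c / N + N))"
  using c
proof (induction m arbitrary: c w)
  case 0
  hence "c 1 = 0" by simp
  note * = greedy_rest_close_boundary[OF f e this 0]
  have "L * (3 * e) \<le> L * (3 * e + 2 / e * (spread 0 c / N + N))"
  proof (intro mult_left_mono)
    show "0 \<le> L" using f[of 1 0] by simp
    have "0 \<le> spread 0 c" unfolding spread_def by (intro sum_nonneg) auto
    thus "3 * e \<le> 3 * e + 2 / e * (spread 0 c / N + N)" using e N by simp
  qed
  thus ?case using *[of w] by simp
next
  case (Suc m)
  have L: "L \<ge> 0" using f[of 1 0] by simp
  show ?case
  proof (cases "\<exists>j. c j = 0")
    case True
    then obtain j where j: "c j = 0" ..
    have "4 / e * real (Suc m) \<le> 4 / e * ((spread (Suc m) c / N + N) / 2)"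
      using e by (intro mult_left_mono spread_boundary[of c j] j N) auto
    also have "\<dots> = 2 / e * (spread (Suc m) c / N + N)"
    proof -
      have "4 / e * (x / 2) = 2 / e * x" for x by simp
      thus ?thesis .
    qed
    finally have "L * (3 * e + 4 / e * real (Suc m)) \<le> L * (3 * e + 2 / e * (spread (Suc m) c / N + N))"
      using L by (intro mult_left_mono add_left_mono)
    thus ?thesis using greedy_rest_close_boundary[OF f e j Suc.prems, of w] by linarith
  next
    case False
    hence pos: "c i > 0" for i by auto
    let ?u = "\<lambda>r v. measure_pmf.expectation (greedy_rest m (use_move c r)) (\<lambda>y. f (v + of_int y))"
    let ?v = "\<lambda>r v. measure_pmf.expectation (iid_sum uniform_step m)
      (\<lambda>x. f (limit_score (position v m (use_move c r) + x)))"
    let ?B = "\<lambda>r. L * (3 * e + 2 / e * (spread m (use_move c r) / N + N))"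
    have u: "measure_pmf.expectation (greedy_rest (Suc m) c) (\<lambda>s. f (w + of_int s)) =
      (\<Sum>r\<in>UNIV. \<Sum>s\<in>UNIV. ?u r (w + of_int (round_score (r, s)))) / 9"
      unfolding expectation_greedy_rest_three[OF pos] by (simp add: add.assoc)
    have v: "measure_pmf.expectation (iid_sum uniform_step (Suc m)) (\<lambda>x. f (limit_score (position w (Suc m) c + x))) =
      (\<Sum>r\<in>UNIV. \<Sum>s\<in>UNIV. ?v r (w + of_int (round_score (r, s)))) / 9"
      unfolding expectation_iid_sum_Suc[OF finite_uniform_step] expectation_uniform_step
      by (simp only: add.assoc[symmetric] position_step[OF pos])
    have "\<bar>(\<Sum>r\<in>UNIV. \<Sum>s\<in>UNIV. ?u r (w + of_int (round_score (r, s)))) -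
       (\<Sum>r\<in>UNIV. \<Sum>s\<in>UNIV. ?v r (w + of_int (round_score (r, s))))\<bar> =
       \<bar>\<Sum>r\<in>UNIV. \<Sum>s\<in>UNIV. ?u r (w + of_int (round_score (r, s))) - ?v r (w + of_int (round_score (r, s)))\<bar>"
      by (simp only: sum_subtractf)
    also have "\<dots> \<le> (\<Sum>r\<in>UNIV. \<Sum>s\<in>(UNIV :: move set). ?B r)"
      by (intro order_trans[OF sum_abs] sum_mono Suc.IH[OF sum_use_move[OF pos Suc.prems]])
    also have "\<dots> = 9 * (L * (3 * e + 2 / e * ((\<Sum>r\<in>UNIV. spread m (use_move c r)) / 3 / N + N)))"
      using e N by (simp add: sum_move[of _ 1] field_simps)
    also have "\<dots> = 9 * (L * (3 * e + 2 / e * (spread (Suc m) c / N + N)))"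
      unfolding spread_harmonic[OF pos] by simp
    finally have bound: "\<bar>(\<Sum>r\<in>UNIV. \<Sum>s\<in>UNIV. ?u r (w + of_int (round_score (r, s)))) -
       (\<Sum>r\<in>UNIV. \<Sum>s\<in>UNIV. ?v r (w + of_int (round_score (r, s))))\<bar> \<le>
       9 * (L * (3 * e + 2 / e * (spread (Suc m) c / N + N)))" .
    have "\<bar>x / 9\<bar> \<le> b" if "\<bar>x\<bar> \<le> 9 * b" for x b :: real using that by (simp add: abs_divide)
    from this[OF bound] show ?thesis unfolding u v diff_divide_distrib[symmetric] .
  qed
qed

text \<open>
  At the start the spread is \<open>18 * n\<close>. The uniform phase ends with \<open>m\<close> of order \<open>N = sqrt n\<close>, and the fluctuations
  after it have order \<open>e = sqrt N\<close>; with these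
  parameters the bound is \<open>L / N * (3 * e + 2 / e * (18 + 1) * N)\<close>, and \<open>3 + 2 * 19 = 41\<close>.
\<close>
theorem greedy_score_close:
  fixes f :: "real \<Rightarrow> real"
  assumes f: "\<And>x y. \<bar>f x - f y\<bar> \<le> L * \<bar>x - y\<bar>" and n: "n > 0"
  shows "\<bar>measure_pmf.expectation (greedy_score n) (\<lambda>s. f (of_int s / sqrt n)) -
      measure_pmf.expectation (iid_sum uniform_step (3 * n)) (\<lambda>x. f (limit_score (x /\<^sub>R sqrt n)))\<bar>
    \<le> 41 * L / sqrt (sqrt n)"
proof -
  define N where "N = sqrt n"
  define e where "e = sqrt N"
  have N: "N > 0" "N * N = real n" and e: "e > 0" "e * e = N" using n by (auto simp: N_def e_def)
  have "\<bar>f (x / N) - f (y / N)\<bar> \<le> L / N * \<bar>x - y\<bar>" for x y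
    using f[of "x / N" "y / N"] N by (simp add: abs_divide flip: diff_divide_distrib)
  note * = greedy_rest_close[of "\<lambda>x. f (x / N)", OF this e(1) N(1), of "\<lambda>_. n" "3 * n" 0]
  have "position 0 (3 * n) (\<lambda>_. n) = 0" by (simp add: position_def vec_eq_iff zero_prod_def)
  moreover have "spread (3 * n) (\<lambda>_. n) = 18 * (N * N)" unfolding N(2) by (simp add: spread_def)
  moreover have "limit_score (x /\<^sub>R N) = limit_score x / N" for x
    using N by (simp add: limit_score_scale divide_inverse mult.commute)
  moreover have "L / N * (3 * e + 2 / e * (18 * (N * N) / N + N)) = 41 * L / e"
  proof -
    have "2 / e * (18 * (N * N) / N + N) = 38 * e" using N e by (simp add: field_simps)
    hence "L / N * (3 * e + 2 / e * (18 * (N * N) / N + N)) = 41 * L * e / (e * e)" unfolding e(2) by simp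
    thus ?thesis using e(1) by simp
  qed
  ultimately show ?thesis using * unfolding greedy_score_eq_greedy_rest N_def[symmetric] e_def[symmetric]
    by simp
qed

section \<open>The characteristic function of the Gaussian limit\<close>

lemma (in prob_space) normal_square_integrable:
  assumes s: "\<sigma> > 0" and D: "distributed M lborel X (normal_density \<mu> \<sigma>)"
  shows "integrable M X" "integrable M (\<lambda>\<omega>. (X \<omega>)\<^sup>2)"
proof -
  have X: "integrable M X"
    using distributed_integrable[OF D, of "\<lambda>x. x"] integrable_normal_moment_nz_1[OF s, of \<mu>] by simp
  have "integrable M (\<lambda>\<omega>. (X \<omega> - \<mu>)\<^sup>2)"
    using distributed_integrable[OF D, of "\<lambda>x. (x - \<mu>)\<^sup>2"] integrable_normal_moment[OF s, of \<mu> 2] by simp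
  hence "integrable M (\<lambda>\<omega>. (X \<omega> - \<mu>)\<^sup>2 + (2 * \<mu> * X \<omega> - \<mu>\<^sup>2))" using X by simp
  thus "integrable M (\<lambda>\<omega>. (X \<omega>)\<^sup>2)" by (simp add: power2_diff algebra_simps)
  show "integrable M X" by (fact X)
qed

lemma (in prob_space) normal_characteristic_function:
  assumes s: "\<sigma> > 0" and D: "distributed M lborel X (normal_density 0 \<sigma>)"
  shows "(CLINT \<omega>|M. iexp (t * X \<omega>)) = complex_of_real (exp (- (t * \<sigma>)\<^sup>2 / 2))"
proof -
  have D': "distributed M lborel (\<lambda>\<omega>. X \<omega> / \<sigma>) std_normal_density"
    using D normal_standard_normal_convert[OF s, of X 0] by simp
  have m: "(\<lambda>\<omega>. X \<omega> / \<sigma>) \<in> borel_measurable M" using distributed_measurable[OF D'] by simp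
  have "distr M borel (\<lambda>\<omega>. X \<omega> / \<sigma>) = std_normal_distribution"
    using distributed_distr_eq_density[OF D'] by (simp cong: distr_cong)
  hence "char (distr M borel (\<lambda>\<omega>. X \<omega> / \<sigma>)) (t * \<sigma>) = complex_of_real (exp (- (t * \<sigma>)\<^sup>2 / 2))"
    by (simp add: char_std_normal_distribution)
  thus ?thesis using m s by (simp add: char_def integral_distr)
qed

text \<open>
  The two alternatives in the definition of joint normality lead to the same formula, a
  constant being a normal variable of variance \<open>0\<close>.
\<close>
lemma (in prob_space) normal_or_constant:
  assumes X: "X \<in> borel_measurable M"
    and "(\<exists>c. AE \<omega> in M. X \<omega> = c) \<or> (\<exists>\<mu> \<sigma>. \<sigma> > 0 \<and> distributed M lborel X (normal_density \<mu> \<sigma>))"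
  shows normal_or_constant_integrable: "integrable M X" "integrable M (\<lambda>\<omega>. (X \<omega>)\<^sup>2)"
    and normal_or_constant_characteristic_function:
      "expectation X = 0 \<Longrightarrow> (CLINT \<omega>|M. iexp (X \<omega>)) = complex_of_real (exp (- expectation (\<lambda>\<omega>. (X \<omega>)\<^sup>2) / 2))"
proof -
  have "integrable M X \<and> integrable M (\<lambda>\<omega>. (X \<omega>)\<^sup>2) \<and> (expectation X = 0 \<longrightarrow>
      (CLINT \<omega>|M. iexp (X \<omega>)) = complex_of_real (exp (- expectation (\<lambda>\<omega>. (X \<omega>)\<^sup>2) / 2)))"
    using assms(2)
  proof (elim disjE exE conjE)
    fix c assume c: "AE \<omega> in M. X \<omega> = c"
    have "integrable M X \<longleftrightarrow> integrable M (\<lambda>_. c)" using X c by (intro integrable_cong_AE) auto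
    moreover have "integrable M (\<lambda>\<omega>. (X \<omega>)\<^sup>2) \<longleftrightarrow> integrable M (\<lambda>_. c\<^sup>2)"
      using X c by (intro integrable_cong_AE) auto
    moreover have "expectation X = expectation (\<lambda>_. c)" using X c by (intro integral_cong_AE) auto
    moreover have "expectation (\<lambda>\<omega>. (X \<omega>)\<^sup>2) = expectation (\<lambda>_. c\<^sup>2)" using X c by (intro integral_cong_AE) auto
    moreover have "(CLINT \<omega>|M. iexp (X \<omega>)) = (CLINT \<omega>|M. iexp c)" using X c by (intro integral_cong_AE) auto
    ultimately show ?thesis by (simp add: prob_space)
  next
    fix \<mu> \<sigma> :: real assume s: "\<sigma> > 0" and D: "distributed M lborel X (normal_density \<mu> \<sigma>)"
    note mean = normal_distributed_expectation[OF s D] and var = normal_distributed_variance[OF s D]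
    have "(CLINT \<omega>|M. iexp (X \<omega>)) = complex_of_real (exp (- expectation (\<lambda>\<omega>. (X \<omega>)\<^sup>2) / 2))"
      if "expectation X = 0"
    proof -
      have "\<mu> = 0" using mean that by simp
      thus ?thesis using normal_characteristic_function[OF s D[unfolded \<open>\<mu> = 0\<close>], of 1] var that by simp
    qed
    thus ?thesis using normal_square_integrable[OF s D] by simp
  qed
  thus "integrable M X" "integrable M (\<lambda>\<omega>. (X \<omega>)\<^sup>2)"
    "expectation X = 0 \<Longrightarrow> (CLINT \<omega>|M. iexp (X \<omega>)) = complex_of_real (exp (- expectation (\<lambda>\<omega>. (X \<omega>)\<^sup>2) / 2))"
    by auto
qed

lemma (in prob_space) multivariate_normal_characteristic_function:
  fixes V :: "'a \<Rightarrow> real^'n"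
  assumes V: "multivariate_normal M V 0 \<Sigma>"
  shows "(CLINT \<omega>|M. iexp (v \<bullet> V \<omega>)) =
    complex_of_real (exp (- (\<Sum>i\<in>UNIV. \<Sum>j\<in>UNIV. v $ i * v $ j * \<Sigma> $ i $ j) / 2))"
proof -
  have jn: "V \<in> borel_measurable M" and lin: "\<And>t. (\<exists>c. AE \<omega> in M. t \<bullet> V \<omega> = c) \<or>
      (\<exists>\<mu> \<sigma>. \<sigma> > 0 \<and> distributed M lborel (\<lambda>\<omega>. t \<bullet> V \<omega>) (normal_density \<mu> \<sigma>))"
    and mean: "\<And>i. expectation (\<lambda>\<omega>. V \<omega> $ i) = 0"
    and cov: "\<And>i j. expectation (\<lambda>\<omega>. V \<omega> $ i * V \<omega> $ j) = \<Sigma> $ i $ j"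
    using V unfolding multivariate_normal_def jointly_normal_def by auto
  have m: "(\<lambda>\<omega>. t \<bullet> V \<omega>) \<in> borel_measurable M" for t using jn by measurable
  note nc = normal_or_constant[OF m lin]
  have comp: "axis i 1 \<bullet> V \<omega> = V \<omega> $ i" for i \<omega> by (simp add: inner_axis')
  have int1: "integrable M (\<lambda>\<omega>. V \<omega> $ i)" and int2: "integrable M (\<lambda>\<omega>. (V \<omega> $ i)\<^sup>2)" for i
    using nc(1)[of "axis i 1"] nc(2)[of "axis i 1"] unfolding comp by auto
  have int: "integrable M (\<lambda>\<omega>. V \<omega> $ i * V \<omega> $ j)" for i j
  proof (rule Bochner_Integration.integrable_bound)
    show "integrable M (\<lambda>\<omega>. (V \<omega> $ i)\<^sup>2 + (V \<omega> $ j)\<^sup>2)" using int2 by simp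
    show "(\<lambda>\<omega>. V \<omega> $ i * V \<omega> $ j) \<in> borel_measurable M"
      using int1 by (intro borel_measurable_times) auto
    have "\<bar>x * y\<bar> \<le> x\<^sup>2 + y\<^sup>2" for x y :: real
      using zero_le_power2[of "\<bar>x\<bar> - \<bar>y\<bar>"] zero_le_power2[of x] zero_le_power2[of y]
      unfolding abs_mult power2_diff power2_abs by linarith
    thus "AE \<omega> in M. norm (V \<omega> $ i * V \<omega> $ j) \<le> norm ((V \<omega> $ i)\<^sup>2 + (V \<omega> $ j)\<^sup>2)" by simp
  qed
  have "expectation (\<lambda>\<omega>. v \<bullet> V \<omega>) = 0"
    using int1 mean by (simp add: inner_vec_def)
  moreover have "expectation (\<lambda>\<omega>. (v \<bullet> V \<omega>)\<^sup>2) = (\<Sum>i\<in>UNIV. \<Sum>j\<in>UNIV. v $ i * v $ j * \<Sigma> $ i $ j)"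
  proof -
    have "(v \<bullet> V \<omega>)\<^sup>2 = (\<Sum>i\<in>UNIV. \<Sum>j\<in>UNIV. v $ i * v $ j * (V \<omega> $ i * V \<omega> $ j))" for \<omega>
      by (simp add: inner_vec_def power2_eq_square sum_product mult_ac)
    thus ?thesis using int by (simp add: cov)
  qed
  ultimately show ?thesis using nc(3)[of v] by simp
qed

lemma sets_vimage_algebra_comp:
  fixes f :: "'b::topological_space \<Rightarrow> 'c::topological_space"
  assumes "f \<in> borel_measurable borel"
  shows "sigma_sets \<Omega> {(f \<circ> X) -` A \<inter> \<Omega> |A. A \<in> sets borel} \<subseteq> sets (vimage_algebra \<Omega> X borel)"
proof (rule sets.sigma_sets_subset[where M = "vimage_algebra \<Omega> X borel", simplified])
  show "{(f \<circ> X) -` A \<inter> \<Omega> |A. A \<in> sets borel} \<subseteq> sets (vimage_algebra \<Omega> X borel)"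
  proof safe
    fix A :: "'c set" assume "A \<in> sets borel"
    hence "f -` A \<in> sets borel" using measurable_sets[OF assms, of A] by simp
    moreover have "(f \<circ> X) -` A \<inter> \<Omega> = X -` (f -` A) \<inter> \<Omega>" by auto
    ultimately show "(f \<circ> X) -` A \<inter> \<Omega> \<in> sets (vimage_algebra \<Omega> X borel)"
      by (simp only: in_vimage_algebra)
  qed
qed

text \<open>
  Independence of the generated sigma-algebras passes to measurable functions of the two variables. The variables
  may have different codomains, whereas \<open>indep_var\<close> requires the functions of them to have the same.
\<close>
lemma (in prob_space) indep_var_of_vimage_algebras:
  fixes f :: "'b::topological_space \<Rightarrow> 'd::topological_space" and g :: "'c::topological_space \<Rightarrow> 'd"
  assumes "X \<in> borel_measurable M" "Y \<in> borel_measurable M"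
    and fg: "f \<in> borel_measurable borel" "g \<in> borel_measurable borel"
    and indep: "indep_set (sets (vimage_algebra (space M) X borel)) (sets (vimage_algebra (space M) Y borel))"
  shows "indep_var borel (f \<circ> X) borel (g \<circ> Y)"
  unfolding indep_var_eq
proof (intro conjI)
  show "indep_set (sigma_sets (space M) {(f \<circ> X) -` A \<inter> space M |A. A \<in> sets borel})
      (sigma_sets (space M) {(g \<circ> Y) -` A \<inter> space M |A. A \<in> sets borel})"
    using indep sets_vimage_algebra_comp[OF fg(1), of "space M" X]
      sets_vimage_algebra_comp[OF fg(2), of "space M" Y] unfolding indep_set_def
    by (elim indep_sets_mono_sets) (auto split: bool.splits)
qed (use assms in auto)

lemma sum_equicorrelated_3:
  fixes v :: "real^3"
  shows "(\<Sum>i\<in>UNIV. \<Sum>j\<in>UNIV. v $ i * v $ j * (vector [vector [ 2/3, -1/3, -1/3],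
      vector [-1/3,  2/3, -1/3], vector [-1/3, -1/3,  2/3]] :: real^3^3) $ i $ j) =
    (\<Sum>i\<in>UNIV. (v $ i)\<^sup>2) - (\<Sum>i\<in>UNIV. v $ i)\<^sup>2 / 3"
  by (simp add: sum_3 vector_3 power2_eq_square field_simps)

lemma (in prob_space) limit_characteristic_function:
  fixes V :: "'a \<Rightarrow> real^3"
  assumes indep: "indep_set (sets (vimage_algebra (space M) W borel)) (sets (vimage_algebra (space M) V borel))"
    and W: "distributed M lborel W (normal_density 0 (sqrt 2))"
    and V: "multivariate_normal M V 0 (vector [vector [ 2/3, -1/3, -1/3],
      vector [-1/3,  2/3, -1/3], vector [-1/3, -1/3,  2/3]])"
  shows "(CLINT \<omega>|M. iexp ((a, v) \<bullet> (W \<omega>, V \<omega>))) =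
    complex_of_real (exp (- (2 * a\<^sup>2 + ((\<Sum>i\<in>UNIV. (v $ i)\<^sup>2) - (\<Sum>i\<in>UNIV. v $ i)\<^sup>2 / 3)) / 2))"
proof -
  have mW: "W \<in> borel_measurable M" using distributed_measurable[OF W] by simp
  have mV: "V \<in> borel_measurable M" using V by (simp add: multivariate_normal_def jointly_normal_def)
  have "indep_var borel ((\<lambda>x. a * x) \<circ> W) borel ((\<lambda>x. v \<bullet> x) \<circ> V)"
    by (intro indep_var_of_vimage_algebras mW mV indep) auto
  hence "char (distr M borel (\<lambda>\<omega>. a * W \<omega> + v \<bullet> V \<omega>)) 1 =
      char (distr M borel (\<lambda>\<omega>. a * W \<omega>)) 1 * char (distr M borel (\<lambda>\<omega>. v \<bullet> V \<omega>)) 1"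
    using char_distr_add unfolding o_def by blast
  moreover have "(\<lambda>\<omega>. a * W \<omega>) \<in> borel_measurable M" "(\<lambda>\<omega>. v \<bullet> V \<omega>) \<in> borel_measurable M"
    using mW mV by measurable
  ultimately have "(CLINT \<omega>|M. iexp (a * W \<omega> + v \<bullet> V \<omega>)) =
      (CLINT \<omega>|M. iexp (a * W \<omega>)) * (CLINT \<omega>|M. iexp (v \<bullet> V \<omega>))"
    by (simp add: char_def integral_distr)
  also have "(CLINT \<omega>|M. iexp (a * W \<omega>)) = complex_of_real (exp (- a\<^sup>2))"
    using normal_characteristic_function[OF _ W, of a] by (simp add: power_mult_distrib)
  also have "(CLINT \<omega>|M. iexp (v \<bullet> V \<omega>)) =
      complex_of_real (exp (- ((\<Sum>i\<in>UNIV. (v $ i)\<^sup>2) - (\<Sum>i\<in>UNIV. v $ i)\<^sup>2 / 3) / 2))"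
    using multivariate_normal_characteristic_function[OF V, of v] unfolding sum_equicorrelated_3 .
  finally show ?thesis
    unfolding inner_Pair inner_real_def of_real_mult[symmetric] exp_add[symmetric] by (simp add: field_simps)
qed

section \<open>The limit theorem\<close>

lemma cts_step_lipschitz:
  assumes "a < b"
  shows "\<bar>cts_step a b x - cts_step a b y\<bar> \<le> 1 / (b - a) * \<bar>x - y\<bar>"
proof -
  have eq: "cts_step a b z = max 0 (min 1 ((b - z) / (b - a)))" for z
    using assms by (auto simp: cts_step_def max_def min_def field_simps)
  have "\<bar>max 0 (min 1 p) - max 0 (min 1 q)\<bar> \<le> \<bar>p - q\<bar>" for p q :: real by linarith
  from this[of "(b - x) / (b - a)" "(b - y) / (b - a)"]
  have "\<bar>cts_step a b x - cts_step a b y\<bar> \<le> \<bar>(b - x) / (b - a) - (b - y) / (b - a)\<bar>" unfolding eq .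
  also have "\<dots> = 1 / (b - a) * \<bar>x - y\<bar>"
    using assms by (simp add: abs_divide abs_minus_commute flip: diff_divide_distrib)
  finally show ?thesis .
qed

lemma cts_step_bounded: "\<bar>cts_step a b x\<bar> \<le> 1" if "a < b"
  using that by (auto simp: cts_step_def)

lemma continuous_cts_step: "a < b \<Longrightarrow> continuous_on UNIV (cts_step a b)"
  by (intro uniformly_continuous_imp_continuous cts_step_uniformly_continuous)

text \<open>
  The central limit theorem along \<open>3 * n\<close> steps but with the scaling \<open>sqrt n\<close>; the factor is absorbed
  into the direction \<open>sqrt 3 *\<^sub>R t\<close>.
\<close>
lemma uniform_walk_characteristic_function:
  fixes t :: "real \<times> (real^3)"
  shows "(\<lambda>n. CLINT x|iid_sum uniform_step (3 * n). iexp (t \<bullet> (x /\<^sub>R sqrt n))) \<longlonglongrightarrow>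
    complex_of_real (exp (- (3 * measure_pmf.expectation uniform_step (\<lambda>x. (t \<bullet> x)\<^sup>2)) / 2))"
proof -
  let ?t = "sqrt 3 *\<^sub>R t"
  have "(\<lambda>n. CLINT x|iid_sum uniform_step n. iexp ((?t \<bullet> x) / sqrt (real n))) \<longlonglongrightarrow>
      complex_of_real (exp (- measure_pmf.expectation uniform_step (\<lambda>x. (?t \<bullet> x)\<^sup>2) / 2))"
    by (intro characteristic_function_clt finite_uniform_step mean_uniform_step)
  moreover have "filterlim (\<lambda>n :: nat. 3 * n) at_top sequentially"
    by (rule filterlim_subseq) (auto simp: strict_mono_def)
  ultimately have "(\<lambda>n. CLINT x|iid_sum uniform_step (3 * n). iexp ((?t \<bullet> x) / sqrt (real (3 * n)))) \<longlonglongrightarrow>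
      complex_of_real (exp (- measure_pmf.expectation uniform_step (\<lambda>x. (?t \<bullet> x)\<^sup>2) / 2))"
    by (rule filterlim_compose)
  moreover have scale: "(?t \<bullet> x) / sqrt (real (3 * n)) = t \<bullet> (x /\<^sub>R sqrt n)" for x n
    by (simp add: real_sqrt_mult divide_inverse)
  moreover have var: "measure_pmf.expectation uniform_step (\<lambda>x. (?t \<bullet> x)\<^sup>2) =
      3 * measure_pmf.expectation uniform_step (\<lambda>x. (t \<bullet> x)\<^sup>2)"
    by (simp add: power_mult_distrib)
  ultimately show ?thesis by (simp only: scale var)
qed

text \<open>
  Three times the covariance of a step is the covariance of \<open>(W, V)\<close>: \<open>3 * (2 / 3) = 2\<close> for the score, and
  the centred projection \<open>I - J / 3\<close>, with \<open>J\<close> the all-ones matrix, for the moves.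
\<close>
lemma (in prob_space) uniform_walk_limit:
  fixes V :: "'a \<Rightarrow> real^3" and f :: "real \<times> (real^3) \<Rightarrow> real"
  assumes indep: "indep_set (sets (vimage_algebra (space M) W borel)) (sets (vimage_algebra (space M) V borel))"
    and W: "distributed M lborel W (normal_density 0 (sqrt 2))"
    and V: "multivariate_normal M V 0 (vector [vector [ 2/3, -1/3, -1/3],
      vector [-1/3,  2/3, -1/3], vector [-1/3, -1/3,  2/3]])"
    and f: "continuous_on UNIV f" "\<And>x. \<bar>f x\<bar> \<le> B"
  shows "(\<lambda>n. measure_pmf.expectation (iid_sum uniform_step (3 * n)) (\<lambda>x. f (x /\<^sub>R sqrt n)))
    \<longlonglongrightarrow> expectation (\<lambda>\<omega>. f (W \<omega>, V \<omega>))"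
proof -
  have [measurable]: "W \<in> borel_measurable M" "V \<in> borel_measurable M"
    using distributed_measurable[OF W] V by (simp_all add: multivariate_normal_def jointly_normal_def)
  interpret characteristic_convergence M "\<lambda>n. measure_pmf (iid_sum uniform_step (3 * n))"
    "\<lambda>n x. x /\<^sub>R sqrt (real n)" "\<lambda>\<omega>. (W \<omega>, V \<omega>)"
  proof
    show "(\<lambda>\<omega>. (W \<omega>, V \<omega>)) \<in> borel_measurable M" by measurable
    fix t :: "real \<times> (real^3)"
    obtain a v where t: "t = (a, v)" by (cases t)
    have cov: "3 * (2 / 3 * x + y / 3) = 2 * x + y" for x y :: real by simp
    show "(\<lambda>n. CLINT x|iid_sum uniform_step (3 * n). iexp (t \<bullet> (x /\<^sub>R sqrt n))) \<longlonglongrightarrow>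
        (CLINT \<omega>|M. iexp (t \<bullet> (W \<omega>, V \<omega>)))"
      using uniform_walk_characteristic_function[of t]
      unfolding t limit_characteristic_function[OF indep W V] variance_uniform_step
      unfolding cov .
  qed simp
  show ?thesis by (rule bounded_continuous_conv[OF f])
qed

theorem theorem3p2:
  fixes M :: "'a measure" and W :: "'a \<Rightarrow> real" and V :: "'a \<Rightarrow> real^3"
  defines "S \<equiv> (\<lambda>\<omega>. W \<omega> + Max {V \<omega> $ 1 + 2 * V \<omega> $ 2, V \<omega> $ 2 + 2 * V \<omega> $ 3, V \<omega> $ 3 + 2 * V \<omega> $ 1})"
  assumes "prob_space M"
    and "jointly_normal M (\<lambda>\<omega>. (W \<omega>, V \<omega>))"
    and "prob_space.indep_set M (sets (vimage_algebra (space M) W borel))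
           (sets (vimage_algebra (space M) V borel))"
    and "distributed M lborel W (normal_density 0 (sqrt 2))"
    and "multivariate_normal M V 0
           (vector [vector [ 2/3, -1/3, -1/3],
                    vector [-1/3,  2/3, -1/3],
                    vector [-1/3, -1/3,  2/3]])"
  shows "weak_conv_m scaled_greedy_score (distr M borel S) \<and>
    (\<forall>k. integrable M (\<lambda>\<omega>. S \<omega> ^ k) \<and>
         (\<lambda>n. integral\<^sup>L (scaled_greedy_score n) (\<lambda>x. x ^ k)) \<longlonglongrightarrow> integral\<^sup>L M (\<lambda>\<omega>. S \<omega> ^ k))"
proof -
  interpret prob_space M by fact
  have [measurable]: "W \<in> borel_measurable M" "V \<in> borel_measurable M"
    using distributed_measurable[OF assms(5)] assms(6)
    by (simp_all add: multivariate_normal_def jointly_normal_def)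
  have S: "S = (\<lambda>\<omega>. limit_score (W \<omega>, V \<omega>))" by (simp add: S_def limit_score_def)
  have [measurable]: "S \<in> borel_measurable M"
    unfolding S by (rule measurable_compose[OF _ borel_measurable_continuous_onI[OF continuous_limit_score]]) measurable
  have fin: "finite (set_pmf (greedy_score n))" for n by (simp add: greedy_score_eq_greedy_rest)
  have score: "integral\<^sup>L (scaled_greedy_score n) h = measure_pmf.expectation (greedy_score n) (\<lambda>s. h (of_int s / sqrt n))"
    if "h \<in> borel_measurable borel" for n and h :: "real \<Rightarrow> real"
    using that by (simp add: scaled_greedy_score_def integral_distr)
  have dist_n: "real_distribution (scaled_greedy_score n)" for n
    unfolding scaled_greedy_score_def by (intro prob_space.real_distribution_distr prob_space_measure_pmf) simp
  have dist: "real_distribution (distr M borel S)" by (intro real_distribution_distr) simp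
  have weak: "weak_conv_m scaled_greedy_score (distr M borel S)"
  proof (rule integral_cts_step_conv_imp_weak_conv[OF dist_n dist])
    fix a b :: real assume ab: "a < b"
    note cont = continuous_cts_step[OF ab]
    have [measurable]: "cts_step a b \<in> borel_measurable borel" by (rule borel_measurable_continuous_onI[OF cont])
    let ?u = "\<lambda>n. measure_pmf.expectation (greedy_score n) (\<lambda>s. cts_step a b (of_int s / sqrt n))"
    let ?v = "\<lambda>n. measure_pmf.expectation (iid_sum uniform_step (3 * n)) (\<lambda>x. cts_step a b (limit_score (x /\<^sub>R sqrt n)))"
    have "?v \<longlonglongrightarrow> expectation (\<lambda>\<omega>. cts_step a b (S \<omega>))"
      unfolding S using assms(4-6) continuous_on_compose2[OF cont continuous_limit_score] cts_step_bounded[OF ab]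
      by (intro uniform_walk_limit) auto
    moreover have "(\<lambda>n. ?u n - ?v n) \<longlonglongrightarrow> 0"
    proof (rule Lim_null_comparison)
      show "\<forall>\<^sub>F n in sequentially. norm (?u n - ?v n) \<le> 41 * (1 / (b - a)) / sqrt (sqrt n)"
        using eventually_gt_at_top[of 0]
        by eventually_elim (unfold real_norm_def, rule greedy_score_close[OF cts_step_lipschitz[OF ab]])
      show "(\<lambda>n. 41 * (1 / (b - a)) / sqrt (sqrt (real n))) \<longlonglongrightarrow> 0"
        by (intro real_tendsto_divide_at_top[OF tendsto_const] filterlim_compose[OF sqrt_at_top]
            filterlim_real_sequentially)
    qed
    ultimately have "(\<lambda>n. (?u n - ?v n) + ?v n) \<longlonglongrightarrow> 0 + expectation (\<lambda>\<omega>. cts_step a b (S \<omega>))"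
      by (intro tendsto_add)
    thus "(\<lambda>n. integral\<^sup>L (scaled_greedy_score n) (cts_step a b)) \<longlonglongrightarrow> integral\<^sup>L (distr M borel S) (cts_step a b)"
      by (simp add: score integral_distr)
  qed
  interpret weak_convergence_bounded_moments "distr M borel S" scaled_greedy_score "\<lambda>k. fact (2 * k) * (6 * exp 15)"
  proof (intro weak_convergence_bounded_moments.intro weak_convergence_bounded_moments_axioms.intro dist dist_n weak)
    show "integrable (scaled_greedy_score n) (\<lambda>x. x ^ k)" for n k
      unfolding scaled_greedy_score_def by (simp add: integrable_distr_eq integrable_measure_pmf_finite fin)
    show "integral\<^sup>L (scaled_greedy_score n) (\<lambda>x. x ^ (2 * k)) \<le> fact (2 * k) * (6 * exp 15)" for n k
      using greedy_score_moment_bound[where n = n and k = k] by (simp add: score)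
  qed
  show ?thesis
    using weak moment_integrable moment_conv by (simp add: integrable_distr_eq integral_distr)
qed

end
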